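(* Let $k \ge 2$ be an integer and let $p = p(n) \in [0,1]$ be a function of $n$ such that $pn \to \infty$ as $n \to \infty$. Then, with high probability as $n \to \infty$, the largest family $\mathcal{A} \subset \mathcal{P}(n,p)$ containing no $k$-chain has size $$|\mathcal{A}| = \big(k-1+o(1)\big)\, p \binom{n}{\lfloor n/2\rfloor}.$$ That is, for every $\varepsilon > 0$, the probability that the maximum size $M_n$ of a sub-family of $\mathcal{P}(n,p)$ containing no $k$-chain satisfies $\big|M_n - (k-1)p\binom{n}{\lfloor n/2\rfloor}\big| \le \varepsilon p \binom{n}{\lfloor n/2\rfloor}$ tends to $1$ as $n \to \infty$.
   Context: $\mathcal{P}(n)$ denotes the family of all subsets of $\{1,\dots,n\}$. $\mathcal{P}(n,p)$ is the $p$-random sub-family of $\mathcal{P}(n)$: each $A \in \mathcal{P}(n)$ belongs to $\mathcal{P}(n,p)$ with probability $p$, independently for different $A$. A $k$-chain is a collection of $k$ sets $F_1,\dots,F_k$ with $F_1 \supsetneq F_2 \supsetneq \cdots \supsetneq F_k$. "With high probability" means with probability tending to $1$ as $n\to\infty$. *)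

theory Defs
  imports "HOL-Probability.Probability"
begin

text \<open>The $p$-random sub-family of the power set of $\{1,\dots,n\}$: an independent Bernoulli
  indicator for each subset. Meaningful for $p \in [0,1]$ only.\<close>

definition random_family :: "nat \<Rightarrow> real \<Rightarrow> nat set set pmf" where
  "random_family n p =
     map_pmf (\<lambda>X. {A \<in> Pow {1..n}. X A}) (Pi_pmf (Pow {1..n}) False (\<lambda>_. bernoulli_pmf p))"

definition is_k_chain :: "nat \<Rightarrow> 'a set set \<Rightarrow> bool" where
  "is_k_chain k C \<longleftrightarrow>
     (\<exists>F :: nat \<Rightarrow> 'a set. C = F ` {1..k} \<and> (\<forall>i\<in>{1..<k}. F (Suc i) \<subset> F i))"

definition k_chain_free :: "nat \<Rightarrow> 'a set set \<Rightarrow> bool" where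
  "k_chain_free k \<A> \<longleftrightarrow> \<not> (\<exists>C \<subseteq> \<A>. is_k_chain k C)"

text \<open>For finite \<open>\<F>\<close> and \<open>k \<ge> 1\<close> the maximum is over a finite nonempty set,
  since the empty family is then \<open>k\<close>-chain free.\<close>

definition max_k_chain_free :: "nat \<Rightarrow> 'a set set \<Rightarrow> nat" where
  "max_k_chain_free k \<F> = Max {card \<A> | \<A>. \<A> \<subseteq> \<F> \<and> k_chain_free k \<A>}"

end

theory Submission
  imports Defs
begin

text \<open>
  By Mirsky's theorem a \<open>k\<close>-chain free family is a union of \<open>k - 1\<close> antichains, so the upper bound only
  needs that every antichain in the random family has size at most $(1 + o(1)) p N$ with
  $N = \binom{n}{\lfloor n/2 \rfloor}$. Only $o(N)$ sets have $3n/4$ or more elements, so these can be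
  ignored, which keeps supersets plentiful. The bound follows from the container method in two phases.
  Averaging over random maximal chains shows that a family of size $> 6N$ has a member with
  $\Omega(n^3)$ supersets in the family, and one of size $> (1 + \varepsilon) N$ has a member with
  $\Omega(\varepsilon n)$. The graph container algorithm therefore puts every antichain into a
  container of size $(1 + \varepsilon) N$ determined by two fingerprints, of sizes $O(N / n^2)$
  (among all sets) and $O(N / n)$ (among $6N$ sets). Since the fingerprints also have to be contained
  in the random family, the union bound costs only $\exp(o(pN))$ as soon as $pn \to \infty$, which is
  beaten by the Chernoff bound $\exp(-\Omega(pN))$ for a single container.
  The lower bound takes the random family restricted to \<open>k - 1\<close> middle layers.
\<close>

subsection \<open>Antichains and graph containers\<close>

definition antichain :: "'a set set \<Rightarrow> bool" where
  "antichain I \<longleftrightarrow> (\<forall>A\<in>I. \<forall>B\<in>I. \<not> A \<subset> B)"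

text \<open>The counting half of Mirsky's theorem, by induction on \<open>k\<close>. The minimal
  members \<open>M\<close> form an antichain. A chain of \<open>Suc k\<close> sets in \<A> - M
  extends downwards by one more member of \<A>, because its smallest set is not minimal. So the
  remainder is chain free one level lower.\<close>

lemma card_le_of_antichains:
  fixes \<A> :: "'a set set"
  assumes "finite \<A>" and "k_chain_free (Suc k) \<A>"
    and "\<And>I. I \<subseteq> \<A> \<Longrightarrow> antichain I \<Longrightarrow> real (card I) \<le> a"
  shows "real (card \<A>) \<le> real k * a"
  using assms
proof (induction k arbitrary: \<A>)
  case 0
  have "\<A> = {}"
  proof (rule ccontr)
    assume "\<A> \<noteq> {}"
    then obtain A where A: "A \<in> \<A>" by auto
    have "is_k_chain (Suc 0) {A}"
      unfolding is_k_chain_def by (rule exI[of _ "\<lambda>_. A"]) auto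
    with A 0(2) show False unfolding k_chain_free_def by auto
  qed
  then show ?case by simp
next
  case (Suc k)
  define M where "M = {A \<in> \<A>. \<forall>B\<in>\<A>. \<not> B \<subset> A}"
  have MA: "M \<subseteq> \<A>" by (auto simp: M_def)
  have cM: "real (card M) \<le> a"
    by (rule Suc.prems(3)[OF MA]) (auto simp: antichain_def M_def)
  have "k_chain_free (Suc k) (\<A> - M)"
    unfolding k_chain_free_def
  proof (intro notI, elim exE conjE)
    fix C assume C: "C \<subseteq> \<A> - M" "is_k_chain (Suc k) C"
    then obtain F where F: "C = F ` {1..Suc k}" "\<forall>i\<in>{1..<Suc k}. F (Suc i) \<subset> F i"
      unfolding is_k_chain_def by blast
    have "F (Suc k) \<in> F ` {1..Suc k}" by simp
    then have "F (Suc k) \<in> \<A> - M" using C(1) F(1) by blast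
    then obtain B where B: "B \<in> \<A>" "B \<subset> F (Suc k)" unfolding M_def by auto
    \<comment> \<open>Chains are indexed downwards, so the new smallest set goes after the last
      index.\<close>
    define G where "G = F(Suc (Suc k) := B)"
    have "is_k_chain (Suc (Suc k)) (G ` {1..Suc (Suc k)})"
      unfolding is_k_chain_def
    proof (intro exI[of _ G] conjI refl ballI)
      fix i assume "i \<in> {1..<Suc (Suc k)}"
      then show "G (Suc i) \<subset> G i"
        using F(2) B(2) by (cases "i = Suc k") (auto simp: G_def)
    qed
    moreover have "G ` {1..Suc (Suc k)} \<subseteq> \<A>"
    proof
      fix x assume "x \<in> G ` {1..Suc (Suc k)}"
      then obtain i where i: "i \<in> {1..Suc (Suc k)}" "x = G i" by blast
      show "x \<in> \<A>"
      proof (cases "i = Suc (Suc k)")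
        case True then show ?thesis using i B by (simp add: G_def)
      next
        case False
        then have "x = F i" "i \<in> {1..Suc k}" using i by (auto simp: G_def)
        then show ?thesis using C(1) F(1) by blast
      qed
    qed
    ultimately show False using Suc.prems(2) unfolding k_chain_free_def by blast
  qed
  then have "real (card (\<A> - M)) \<le> real k * a"
    using Suc.prems(1,3) by (intro Suc.IH) auto
  moreover have "card \<A> = card M + card (\<A> - M)"
    using MA Suc.prems(1) by (metis card_Diff_subset card_mono finite_subset le_add_diff_inverse)
  ultimately show ?case using cM by (simp add: algebra_simps)
qed

text \<open>The Kleitman-Winston algorithm, as a recursion on \<open>card F\<close>. A vertex
  \<open>v\<close> of degree at least \<open>D\<close> is queried. If \<open>v\<close> lies in
  \<open>I\<close> it joins the fingerprint and at least \<open>D\<close> further candidates are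
  discarded, hence the bound on \<open>card T\<close>. Otherwise only \<open>v\<close> is discarded.
  The recursion stops at size \<open>M\<close>. \<open>N\<close> may be asymmetric, and the size
  bound on \<open>C T\<close> holds for every \<open>T\<close>, including those that never arise as
  fingerprints.\<close>

lemma graph_containers:
  fixes N :: "'a \<Rightarrow> 'a set" and D :: real
  assumes "finite F"
    and supersat: "\<And>G. G \<subseteq> F \<Longrightarrow> real (card G) > M \<Longrightarrow> \<exists>v\<in>G. real (card (N v \<inter> G)) \<ge> D"
    and irrefl: "\<And>v. v \<notin> N v" and "D \<ge> 0" "M \<ge> 0"
  shows "\<exists>C. (\<forall>T. C T \<subseteq> F \<and> real (card (C T)) \<le> M) \<and>
    (\<forall>I\<subseteq>F. (\<forall>v\<in>I. N v \<inter> I = {}) \<longrightarrow>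
      (\<exists>T\<subseteq>I. real (card T) * D \<le> real (card F) \<and> I \<subseteq> T \<union> C T))"
  using assms(1) supersat
proof (induction "card F" arbitrary: F rule: less_induct)
  case less
  note fin = less.prems(1) and sup = less.prems(2)
  show ?case
  proof (cases "real (card F) \<le> M")
    case True
    then show ?thesis by (intro exI[of _ "\<lambda>_. F"]) (auto intro!: exI[of _ "{}"])
  next
    case False
    then obtain v where v: "v \<in> F" "real (card (N v \<inter> F)) \<ge> D" using sup[of F] by auto
    define F1 where "F1 = F - {v} - N v"
    define F2 where "F2 = F - {v}"
    have sub: "F1 \<subseteq> F" "F2 \<subseteq> F" by (auto simp: F1_def F2_def)
    have fins: "finite F1" "finite F2" using fin sub finite_subset by auto
    have "F1 \<subset> F" "F2 \<subset> F" using v(1) by (auto simp: F1_def F2_def)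
    then have lt: "card F1 < card F" "card F2 < card F"
      using fin by (auto intro: psubset_card_mono)
    have "\<exists>v\<in>G. D \<le> real (card (N v \<inter> G))" if "G \<subseteq> F1" "M < real (card G)" for G
      using sup[of G] that sub by auto
    from less.hyps[OF lt(1) fins(1) this]
    obtain C1 where C1: "\<And>T. C1 T \<subseteq> F1 \<and> real (card (C1 T)) \<le> M"
      "\<And>I. I \<subseteq> F1 \<Longrightarrow> \<forall>v\<in>I. N v \<inter> I = {} \<Longrightarrow>
        \<exists>T\<subseteq>I. real (card T) * D \<le> real (card F1) \<and> I \<subseteq> T \<union> C1 T"
      by auto
    have "\<exists>v\<in>G. D \<le> real (card (N v \<inter> G))" if "G \<subseteq> F2" "M < real (card G)" for G
      using sup[of G] that sub by auto
    from less.hyps[OF lt(2) fins(2) this]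
    obtain C2 where C2: "\<And>T. C2 T \<subseteq> F2 \<and> real (card (C2 T)) \<le> M"
      "\<And>I. I \<subseteq> F2 \<Longrightarrow> \<forall>v\<in>I. N v \<inter> I = {} \<Longrightarrow>
        \<exists>T\<subseteq>I. real (card T) * D \<le> real (card F2) \<and> I \<subseteq> T \<union> C2 T"
      by auto
    have card1: "real (card F1) + D \<le> real (card F)"
    proof -
      have "card F1 + card (N v \<inter> F) = card (F1 \<union> (N v \<inter> F))"
        using fin fins by (intro card_Un_disjoint[symmetric]) (auto simp: F1_def)
      also have "\<dots> \<le> card F" using fin sub by (intro card_mono) auto
      finally show ?thesis using v(2) by linarith
    qed
    \<comment> \<open>the fingerprint \<open>T\<close> alone reveals which branch was taken, since \<open>v \<in> T\<close> iff \<open>v \<in> I\<close>\<close>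
    define C where "C T = (if v \<in> T then C1 (T - {v}) else C2 T)" for T
    show ?thesis
    proof (intro exI[of _ C] conjI allI impI)
      fix T show "C T \<subseteq> F" "real (card (C T)) \<le> M"
        using C1(1)[of "T - {v}"] C2(1)[of T] sub by (auto simp: C_def)
    next
      fix I assume I: "I \<subseteq> F" "\<forall>v\<in>I. N v \<inter> I = {}"
      show "\<exists>T\<subseteq>I. real (card T) * D \<le> real (card F) \<and> I \<subseteq> T \<union> C T"
      proof (cases "v \<in> I")
        case True
        have "I - {v} \<subseteq> F1" using I True by (auto simp: F1_def)
        then obtain T where T: "T \<subseteq> I - {v}" "real (card T) * D \<le> real (card F1)"
            "I - {v} \<subseteq> T \<union> C1 T"
          using C1(2)[of "I - {v}"] I(2) by blast
        have "finite T" using T(1) I(1) fin by (meson Diff_subset finite_subset)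
        then have "card (insert v T) = Suc (card T)" using T(1) by (subst card_insert_disjoint) auto
        then have "real (card (insert v T)) * D \<le> real (card F)"
          using T(2) card1 by (simp add: algebra_simps)
        moreover have "insert v T - {v} = T" using T(1) by auto
        then have "I \<subseteq> insert v T \<union> C (insert v T)"
          using T(3) by (auto simp: C_def)
        ultimately show ?thesis using T(1) True by (intro exI[of _ "insert v T"]) auto
      next
        case False
        then have "I \<subseteq> F2" using I by (auto simp: F2_def)
        then obtain T where T: "T \<subseteq> I" "real (card T) * D \<le> real (card F2)" "I \<subseteq> T \<union> C2 T"
          using C2(2)[OF _ I(2)] by auto
        have "v \<notin> T" using T(1) False by auto
        then show ?thesis using T lt(2) by (intro exI[of _ T]) (auto simp: C_def)
      qed
    qed
  qed
qed

subsection \<open>Supersaturation by random maximal chains\<close>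

text \<open>A permutation of \<open>U\<close> encodes the maximal chain of its prefix sets. Passing
  through \<open>A\<close> and \<open>B\<close> means concatenating arbitrary orderings of
  \<open>A\<close>, \<open>B - A\<close> and \<open>U - B\<close>. The case \<open>A = B\<close>
  counts the chains through a single set.\<close>

lemma card_maximal_chains_through_pair:
  fixes U :: "'a set"
  assumes "finite U" "A \<subseteq> B" "B \<subseteq> U"
  shows "card {xs \<in> permutations_of_set U. set (take (card A) xs) = A \<and> set (take (card B) xs) = B}
    = fact (card A) * fact (card B - card A) * fact (card U - card B)"
proof -
  have fin: "finite A" "finite B" using assms by (auto dest: finite_subset)
  have le: "card A \<le> card B" "card B \<le> card U" using assms fin by (auto intro: card_mono)
  let ?S = "permutations_of_set A \<times> permutations_of_set (B - A) \<times> permutations_of_set (U - B)"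
  let ?f = "\<lambda>(xs, ys, zs). xs @ ys @ zs :: 'a list"
  have "{xs \<in> permutations_of_set U. set (take (card A) xs) = A \<and> set (take (card B) xs) = B} = ?f ` ?S"
    (is "?L = _")
  proof (intro equalityI subsetI)
    fix xs assume xs: "xs \<in> ?L"
    then have d: "distinct xs" "set xs = U" "set (take (card A) xs) = A" "set (take (card B) xs) = B"
      by (auto dest: permutations_of_setD)
    define ys where "ys = drop (card A) (take (card B) xs)"
    have e: "take (card B) xs = take (card A) xs @ ys"
      unfolding ys_def using le by (metis append_take_drop_id min.absorb1 take_take)
    then have "xs = take (card A) xs @ ys @ drop (card B) xs"
      by (metis append_assoc append_take_drop_id)
    moreover have "distinct (take (card A) xs @ ys)" using d(1) e by (metis distinct_take)
    then have "take (card A) xs \<in> permutations_of_set A" "ys \<in> permutations_of_set (B - A)"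
      using d(3,4) e by (auto intro!: permutations_of_setI)
    moreover have "drop (card B) xs \<in> permutations_of_set (U - B)"
    proof (rule permutations_of_setI)
      have "distinct (take (card B) xs @ drop (card B) xs)" "set (take (card B) xs @ drop (card B) xs) = U"
        using d(1,2) by simp_all
      then show "set (drop (card B) xs) = U - B" using d(4) unfolding distinct_append set_append by blast
    qed (use d in simp)
    ultimately show "xs \<in> ?f ` ?S"
      by (intro image_eqI[of _ _ "(take (card A) xs, ys, drop (card B) xs)"]) auto
  next
    fix xs assume "xs \<in> ?f ` ?S"
    then obtain a b c where abc: "xs = a @ b @ c" "a \<in> permutations_of_set A"
      "b \<in> permutations_of_set (B - A)" "c \<in> permutations_of_set (U - B)" by auto
    note D = abc(2-4)[THEN permutations_of_setD(1)] abc(2-4)[THEN permutations_of_setD(2)]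
    have len: "length a = card A" "length b = card B - card A"
      using abc fin assms by (auto simp: length_finite_permutations_of_set card_Diff_subset)
    have "take (card A) xs = a" "take (card B) xs = a @ b"
      using len le abc(1) by auto
    moreover have "xs \<in> permutations_of_set U"
      using D assms(2,3) abc(1) by (intro permutations_of_setI) auto
    ultimately show "xs \<in> ?L" using D assms(2) by auto
  qed
  moreover have "inj_on ?f ?S"
  proof (rule inj_onI)
    fix x y assume xy: "x \<in> ?S" "y \<in> ?S" "?f x = ?f y"
    obtain a b c a' b' c' where e: "x = (a, b, c)" "y = (a', b', c')" by (cases x, cases y)
    have "length a = length a'" "length b = length b'"
      using xy(1,2) e fin by (auto simp: length_finite_permutations_of_set)
    then show "x = y" using xy(3) e by simp
  qed
  ultimately have "card ?L = card ?S" by (simp add: card_image)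
  also have "\<dots> = fact (card A) * fact (card B - card A) * fact (card U - card B)"
    using fin assms by (simp add: card_cartesian_product card_Diff_subset)
  finally show ?thesis .
qed

text \<open>Every member of the chain is compared with the largest one, \<open>B\<close>. Sizes are
  distinct, so at most \<open>r\<close> members have size within less than \<open>r\<close> of
  \<open>card B\<close>. Each other member \<open>A\<close> contributes its own far pair
  \<open>(A, B)\<close>.\<close>

lemma card_le_add_card_far_pairs:
  fixes G :: "'a set set"
  assumes "finite G" "inj_on card G" and chain: "\<And>A B. A \<in> G \<Longrightarrow> B \<in> G \<Longrightarrow> card A < card B \<Longrightarrow> A \<subset> B"
    and "r \<ge> 1"
  shows "card G \<le> r + card {(A, B) \<in> G \<times> G. A \<subset> B \<and> card A + r \<le> card B}"
proof (cases "G = {}")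
  case False
  have "Max (card ` G) \<in> card ` G" using assms(1) False by (intro Max_in) auto
  then obtain B where "B \<in> G" "card B = Max (card ` G)" by auto
  then have B: "B \<in> G" "\<And>A. A \<in> G \<Longrightarrow> card A \<le> card B" using assms(1) by auto
  let ?P = "{(A, B) \<in> G \<times> G. A \<subset> B \<and> card A + r \<le> card B}"
  let ?N = "{A \<in> G. card B < card A + r}" and ?Y = "{A \<in> G. card A + r \<le> card B}"
  have "card ?N = card (card ` ?N)"
    using assms(2) by (intro card_image[symmetric]) (auto intro: inj_on_subset)
  also have "\<dots> \<le> card {card B + 1 - r..card B}"
    using B(2) by (intro card_mono) auto
  also have "\<dots> \<le> r" by auto
  finally have N: "card ?N \<le> r" .
  have "card ?Y = card ((\<lambda>A. (A, B)) ` ?Y)"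
    by (intro card_image[symmetric]) (auto intro: inj_onI)
  also have "\<dots> \<le> card ?P"
  proof (intro card_mono finite_subset[of ?P "G \<times> G"])
    have "A \<subset> B" if "A \<in> G" "card A + r \<le> card B" for A
      using that assms(4) B(1) chain[of A B] by simp
    then show "(\<lambda>A. (A, B)) ` ?Y \<subseteq> ?P" using B(1) by blast
  qed (use assms(1) in auto)
  finally have Y: "card ?Y \<le> card ?P" .
  have "card G = card (?N \<union> ?Y)" by (rule arg_cong[of _ _ card]) auto
  also have "\<dots> \<le> card ?N + card ?Y" by (rule card_Un_le)
  finally show ?thesis using N Y by linarith
qed simp

text \<open>A robust form of the LYM inequality, which is the case \<open>r = 1\<close>,
  \<open>d = 0\<close>. A uniformly random maximal chain meets \<open>F\<close> in an expected
  number of members equal to the sum on the left. It contains both sets of a far pair with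
  probability at most 1 / D times that for \<open>A\<close> alone, and \<open>A\<close> lies in at
  most \<open>d\<close> pairs as the smaller set.\<close>

lemma weighted_card_le:
  fixes U :: "'a set" and D d :: real and r :: nat
  assumes "finite U" "F \<subseteq> Pow U" "r \<ge> 1" "D > 0" "d \<ge> 0"
    and D: "\<And>A B. A \<in> F \<Longrightarrow> B \<in> F \<Longrightarrow> A \<subset> B \<Longrightarrow> card A + r \<le> card B \<Longrightarrow>
      D \<le> real ((card U - card A) choose (card B - card A))"
    and d: "\<And>A. A \<in> F \<Longrightarrow> real (card {B \<in> F. A \<subset> B}) \<le> d"
  shows "(\<Sum>A\<in>F. 1 / real (card U choose card A)) * (1 - d / D) \<le> real r"
proof -
  define n where "n = card U"
  define \<Omega> where "\<Omega> = permutations_of_set U"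
  define on where "on xs A \<longleftrightarrow> set (take (card A) xs) = A" for xs and A :: "'a set"
  define P where "P = {(A, B) \<in> F \<times> F. A \<subset> B \<and> card A + r \<le> card B}"
  have finF: "finite F" using assms(1,2) finite_subset by blast
  have cardS: "card A \<le> n" if "A \<in> F" for A
    using that assms(1,2) by (auto intro: card_mono simp: n_def)
  have finP: "finite P" by (rule finite_subset[of _ "F \<times> F"]) (auto simp: P_def finF)
  have fin\<Omega>: "finite \<Omega>" by (simp add: \<Omega>_def)
  have one: "real (card {xs \<in> \<Omega>. on xs A}) = fact n * (1 / real (n choose card A))" if "A \<in> F" for A
  proof -
    have "card {xs \<in> \<Omega>. on xs A} = fact (card A) * fact (n - card A)"
      using card_maximal_chains_through_pair[of U A A] that assms(1,2)
      by (auto simp: \<Omega>_def on_def n_def)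
    then show ?thesis using cardS[OF that] by (simp add: binomial_fact)
  qed
  have two: "real (card {xs \<in> \<Omega>. on xs A \<and> on xs B}) \<le> fact n * (1 / real (n choose card A)) / D"
    if "(A, B) \<in> P" for A B
  proof -
    have AB: "A \<in> F" "B \<in> F" "A \<subset> B" "card A + r \<le> card B" using that by (auto simp: P_def)
    have le: "card A \<le> card B" "card B \<le> n" using AB cardS by auto
    have "real (card {xs \<in> \<Omega>. on xs A \<and> on xs B})
        = fact (card A) * fact (card B - card A) * fact (n - card B)"
      using card_maximal_chains_through_pair[of U A B] AB assms(1,2)
      by (auto simp: \<Omega>_def on_def n_def)
    also have "\<dots> = fact n * (1 / real (n choose card A)) / real ((n - card A) choose (card B - card A))"
      using le by (simp add: binomial_fact)
    also have "\<dots> \<le> fact n * (1 / real (n choose card A)) / D"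
      using D[OF AB] \<open>D > 0\<close> le by (intro divide_left_mono mult_pos_pos) (simp_all add: n_def diff_le_mono)
    finally show ?thesis .
  qed
  \<comment> \<open>The members of \<open>F\<close> that are prefixes of one permutation are nested
    and have distinct sizes. Summing this pointwise bound over all permutations and exchanging sums
    yields the claim.\<close>
  have key: "card {A \<in> F. on xs A} \<le> r + card {(A, B) \<in> P. on xs A \<and> on xs B}" if "xs \<in> \<Omega>" for xs
  proof -
    let ?G = "{A \<in> F. on xs A}"
    have "inj_on card ?G" unfolding on_def by (rule inj_onI) (metis (mono_tags, lifting) mem_Collect_eq)
    moreover have "A \<subset> B" if "A \<in> ?G" "B \<in> ?G" "card A < card B" for A B
      using that set_take_subset_set_take[of "card A" "card B" xs] unfolding on_def by auto
    ultimately have "card ?G \<le> r + card {(A, B) \<in> ?G \<times> ?G. A \<subset> B \<and> card A + r \<le> card B}"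
      using finF \<open>r \<ge> 1\<close> by (intro card_le_add_card_far_pairs) auto
    also have "{(A, B) \<in> ?G \<times> ?G. A \<subset> B \<and> card A + r \<le> card B} = {(A, B) \<in> P. on xs A \<and> on xs B}"
      by (auto simp: P_def)
    finally show ?thesis .
  qed
  define w where "w A = 1 / real (n choose card A)" for A :: "'a set"
  have w0: "w A \<ge> 0" for A by (simp add: w_def)
  have "fact n * (\<Sum>A\<in>F. w A) = (\<Sum>A\<in>F. real (card {xs \<in> \<Omega>. on xs A}))"
    by (simp add: one sum_distrib_left w_def)
  also have "\<dots> = real (\<Sum>A\<in>F. card {xs \<in> \<Omega>. on xs A})" by simp
  also have "(\<Sum>A\<in>F. card {xs \<in> \<Omega>. on xs A}) = (\<Sum>xs\<in>\<Omega>. card {A \<in> F. on xs A})"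
    using sum_multicount_gen[OF fin\<Omega> finF, of on "\<lambda>A. card {xs \<in> \<Omega>. on xs A}"] by simp
  also have "\<dots> \<le> (\<Sum>xs\<in>\<Omega>. r + card {ab \<in> P. on xs (fst ab) \<and> on xs (snd ab)})"
    using key by (intro sum_mono) (simp add: case_prod_unfold)
  also have "\<dots> = r * fact n + (\<Sum>xs\<in>\<Omega>. card {ab \<in> P. on xs (fst ab) \<and> on xs (snd ab)})"
    using assms(1) by (simp add: sum.distrib \<Omega>_def n_def)
  also have "(\<Sum>xs\<in>\<Omega>. card {ab \<in> P. on xs (fst ab) \<and> on xs (snd ab)})
      = (\<Sum>ab\<in>P. card {xs \<in> \<Omega>. on xs (fst ab) \<and> on xs (snd ab)})"
    using sum_multicount_gen[OF fin\<Omega> finP, of "\<lambda>xs ab. on xs (fst ab) \<and> on xs (snd ab)"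
      "\<lambda>ab. card {xs \<in> \<Omega>. on xs (fst ab) \<and> on xs (snd ab)}"] by simp
  finally have "fact n * (\<Sum>A\<in>F. w A)
      \<le> real r * fact n + (\<Sum>ab\<in>P. real (card {xs \<in> \<Omega>. on xs (fst ab) \<and> on xs (snd ab)}))"
    by simp
  also have "(\<Sum>ab\<in>P. real (card {xs \<in> \<Omega>. on xs (fst ab) \<and> on xs (snd ab)}))
      \<le> (\<Sum>ab\<in>P. fact n * w (fst ab) / D)"
    using two by (intro sum_mono) (auto simp: w_def)
  \<comment> \<open>The distance condition is dropped here, so that the up-degree bound
    \<open>d\<close> applies directly.\<close>
  also have "\<dots> \<le> (\<Sum>ab\<in>Sigma F (\<lambda>A. {B \<in> F. A \<subset> B}). fact n * w (fst ab) / D)"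
    using finF w0 \<open>D > 0\<close> by (intro sum_mono2) (auto simp: P_def)
  also have "\<dots> = (\<Sum>A\<in>F. real (card {B \<in> F. A \<subset> B}) * (fact n * w A / D))"
    using finF sum.Sigma[of F "\<lambda>A. {B \<in> F. A \<subset> B}" "\<lambda>A B. fact n * w A / D"]
    by (simp add: split_def)
  also have "\<dots> \<le> (\<Sum>A\<in>F. d * (fact n * w A / D))"
    using d w0 \<open>D > 0\<close> by (intro sum_mono mult_right_mono) auto
  also have "\<dots> = fact n * ((d / D) * (\<Sum>A\<in>F. w A))"
    by (simp add: sum_distrib_left sum_divide_distrib mult_ac)
  finally have "fact n * (\<Sum>A\<in>F. w A) \<le> fact n * (real r + (d / D) * (\<Sum>A\<in>F. w A))"
    by (simp add: algebra_simps)
  then have "(\<Sum>A\<in>F. w A) \<le> real r + (d / D) * (\<Sum>A\<in>F. w A)"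
    by (simp add: mult_le_cancel_left_pos del: mult_le_cancel_left)
  then show ?thesis by (simp add: w_def n_def algebra_simps)
qed

section \<open>Supersaturation: large families have a member of large up-degree\<close>

lemma binomial_ge_of_between:
  assumes "r \<le> j" "j + r \<le> m"
  shows "m choose r \<le> m choose j"
proof (cases "2 * j \<le> m")
  case True
  then show ?thesis using assms by (intro binomial_mono)
next
  case False
  have "m choose r \<le> m choose (m - j)" using assms False by (intro binomial_mono) auto
  then show ?thesis using assms by (simp add: binomial_symmetric[of j m])
qed

text \<open>If all up-degrees were smaller, the weighted inequality would bound
  \<open>card F\<close> by \<open>s\<close> times the central binomial coefficient. Sets below 3n/4
  elements leave more than n/4 elements free above both sets of a pair, which gives the lower bound
  (n / (4r))^r on the number of sets at the relevant level above \<open>A\<close>.\<close>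

lemma exists_large_up_degree:
  fixes U :: "'a set" and s :: real
  assumes "finite U" and F: "F \<subseteq> {A \<in> Pow U. 4 * card A < 3 * card U}"
    and r: "r \<ge> 1" "4 * r \<le> card U" "real r \<le> s"
    and large: "real (card F) > s * real (card U choose (card U div 2))"
  shows "\<exists>A\<in>F. (real (card U) / (4 * real r)) ^ r * (1 - real r / s) \<le> real (card ({B. A \<subset> B} \<inter> F))"
proof (rule ccontr)
  define n where "n = card U"
  define D where "D = (real n / (4 * real r)) ^ r"
  \<comment> \<open>Chosen so that 1 - d / D = r / s, which turns the weighted inequality into the
    bound \<open>s\<close> on the weighted sum.\<close>
  define d where "d = D * (1 - real r / s)"
  assume "\<not> ?thesis"
  then have deg: "real (card {B \<in> F. A \<subset> B}) \<le> d" if "A \<in> F" for A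
    using that by (fastforce simp: d_def D_def n_def Int_def conj_commute)
  have pos: "n > 0" "D > 0" "s > 0" using r by (auto simp: n_def D_def)
  have d0: "d \<ge> 0" using pos r by (simp add: d_def)
  have finF: "finite F" using F assms(1) by (auto intro: finite_subset)
  have "(\<Sum>A\<in>F. 1 / real (n choose card A)) * (1 - d / D) \<le> real r"
    unfolding n_def
  proof (rule weighted_card_le)
    fix A B assume AB: "A \<in> F" "B \<in> F" "A \<subset> B" "card A + r \<le> card B"
    define m where "m = n - card A"
    have c: "4 * card A < 3 * n" "4 * card B < 3 * n" using AB F by (auto simp: n_def)
    have "D \<le> (real m / real r) ^ r"
      unfolding D_def
    proof (rule power_mono)
      have "real n \<le> 4 * real m" using c by (simp add: m_def of_nat_diff)
      then show "real n / (4 * real r) \<le> real m / real r" using r by (simp add: field_simps)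
    qed simp
    also have "\<dots> \<le> real (m choose r)"
      using c r by (intro binomial_ge_n_over_k_pow_k) (auto simp: m_def n_def)
    also have "\<dots> \<le> real (m choose (card B - card A))"
      using c r AB by (intro of_nat_mono binomial_ge_of_between) (auto simp: m_def n_def)
    finally show "D \<le> real (card U - card A choose (card B - card A))" by (simp add: m_def n_def)
  qed (use assms pos d0 deg in auto)
  moreover have "1 - d / D = real r / s" using pos by (simp add: d_def)
  ultimately have "(\<Sum>A\<in>F. 1 / real (n choose card A)) * real r \<le> s * real r"
    using pos by (simp add: field_simps)
  then have "(\<Sum>A\<in>F. 1 / real (n choose card A)) \<le> s" using r by simp
  moreover have "real (card F) / real (n choose (n div 2)) \<le> (\<Sum>A\<in>F. 1 / real (n choose card A))"
  proof -
    have "real (card F) / real (n choose (n div 2)) = (\<Sum>A\<in>F. 1 / real (n choose (n div 2)))" by simp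
    also have "\<dots> \<le> (\<Sum>A\<in>F. 1 / real (n choose card A))"
    proof (rule sum_mono)
      fix A assume "A \<in> F"
      then have "card A \<le> n" using F assms(1) by (auto simp: n_def intro: card_mono)
      then show "1 / real (n choose (n div 2)) \<le> 1 / real (n choose card A)"
        by (intro divide_left_mono mult_pos_pos) (auto simp: binomial_maximum)
    qed
    finally show ?thesis .
  qed
  ultimately have "real (card F) / real (n choose (n div 2)) \<le> s" by linarith
  then have "real (card F) \<le> s * real (n choose (n div 2))" by (simp add: pos_divide_le_eq)
  then show False using large by (simp add: n_def)
qed

text \<open>The container algorithm is run twice for the strict superset relation: on
  \<open>V\<close> down to size \<open>6 * N\<close>, then inside each first container down to size
  (1 + \<epsilon>) N. Starting the second run from O(N) sets rather than all of \<open>V\<close>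
  keeps \<open>S\<close> small although the degree there is only linear in \<open>n\<close>.\<close>

lemma antichain_containers:
  fixes U :: "'a set" and \<epsilon> :: real
  defines "n \<equiv> card U" and "N \<equiv> real (card U choose (card U div 2))"
    and "V \<equiv> {A \<in> Pow U. 4 * card A < 3 * card U}"
  assumes "finite U" "n \<ge> 12" "\<epsilon> > 0"
  shows "\<exists>C1 C2.
    (\<forall>T. C1 T \<subseteq> V - T \<and> real (card (C1 T)) \<le> 6 * N) \<and>
    (\<forall>T S. C2 T S \<subseteq> V - T - S \<and> real (card (C2 T S)) \<le> (1 + \<epsilon>) * N) \<and>
    (\<forall>I\<subseteq>V. antichain I \<longrightarrow> (\<exists>T S. T \<subseteq> I \<and> S \<subseteq> I \<and> S \<subseteq> C1 T \<and> I \<subseteq> T \<union> S \<union> C2 T S \<and>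
      real (card T) \<le> 3456 * 2 ^ n / real n ^ 3 \<and> real (card S) \<le> 24 * (1 + \<epsilon>) * N / (\<epsilon> * real n)))"
proof -
  have finV: "finite V" using assms by (auto simp: V_def)
  have N0: "N \<ge> 0" by (simp add: N_def)
  define nb where "nb A = {B. A \<subset> B}" for A :: "'a set"
  have irr: "A \<notin> nb A" for A by (simp add: nb_def)
  have ind: "\<forall>A\<in>I. nb A \<inter> I = {}" if "antichain I" for I
    using that by (auto simp: antichain_def nb_def)
  \<comment> \<open>The degrees supplied by supersaturation: \<open>D1\<close> is (n / 12)^3 / 2,
    from r = 3 and s = 6, and \<open>D2\<close> is (n / 4) (1 - 1 / (1 + \<epsilon>)), from r = 1
    and s = 1 + \<epsilon>. The case r = 3 requires n at least 12.\<close>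
  define D1 where "D1 = real n ^ 3 / 3456"
  define D2 where "D2 = real n * \<epsilon> / (4 * (1 + \<epsilon>))"
  have D: "D1 > 0" "D2 > 0" using assms(5,6) by (auto simp: D1_def D2_def)
  have "\<exists>C. (\<forall>T. C T \<subseteq> V \<and> real (card (C T)) \<le> 6 * N) \<and>
    (\<forall>I\<subseteq>V. (\<forall>v\<in>I. nb v \<inter> I = {}) \<longrightarrow>
      (\<exists>T\<subseteq>I. real (card T) * D1 \<le> real (card V) \<and> I \<subseteq> T \<union> C T))"
  proof (rule graph_containers)
    fix G assume "G \<subseteq> V" "6 * N < real (card G)"
    then show "\<exists>v\<in>G. D1 \<le> real (card (nb v \<inter> G))"
      using exists_large_up_degree[of U G 3 6] assms
      by (auto simp: D1_def nb_def V_def N_def n_def power_divide)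
  qed (use finV irr D N0 in auto)
  then obtain C where C: "\<And>T. C T \<subseteq> V \<and> real (card (C T)) \<le> 6 * N"
    "\<And>I. I \<subseteq> V \<Longrightarrow> \<forall>v\<in>I. nb v \<inter> I = {} \<Longrightarrow>
        \<exists>T\<subseteq>I. real (card T) * D1 \<le> real (card V) \<and> I \<subseteq> T \<union> C T"
    by auto
  \<comment> \<open>Removing the fingerprint makes it disjoint from the container, so that the
    events on the two parts are independent. The same is done for \<open>C2\<close>.\<close>
  define C1 where "C1 T = C T - T" for T
  have C1: "C1 T \<subseteq> V - T" "real (card (C1 T)) \<le> 6 * N" for T
  proof -
    have "card (C1 T) \<le> card (C T)"
      using C(1)[of T] finV unfolding C1_def by (intro card_mono) (auto dest: finite_subset)
    then show "real (card (C1 T)) \<le> 6 * N" using C(1)[of T] by linarith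
    show "C1 T \<subseteq> V - T" using C(1)[of T] by (auto simp: C1_def)
  qed
  have "\<exists>K. (\<forall>S. K S \<subseteq> C1 T \<and> real (card (K S)) \<le> (1 + \<epsilon>) * N) \<and>
    (\<forall>I\<subseteq>C1 T. (\<forall>v\<in>I. nb v \<inter> I = {}) \<longrightarrow>
      (\<exists>S\<subseteq>I. real (card S) * D2 \<le> real (card (C1 T)) \<and> I \<subseteq> S \<union> K S))" for T
  proof (rule graph_containers)
    show "finite (C1 T)" using C1(1)[of T] finV by (auto dest: finite_subset)
    fix G assume G: "G \<subseteq> C1 T" "(1 + \<epsilon>) * N < real (card G)"
    then have "G \<subseteq> V" using C1(1)[of T] by auto
    moreover have "real n / 4 * (1 - 1 / (1 + \<epsilon>)) = D2"
      using assms(6) by (simp add: D2_def field_simps)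
    ultimately show "\<exists>v\<in>G. D2 \<le> real (card (nb v \<inter> G))"
      using exists_large_up_degree[of U G 1 "1 + \<epsilon>"] G(2) assms
      by (auto simp: nb_def V_def N_def n_def)
  qed (use irr D N0 assms(6) in auto)
  then obtain K where K: "\<And>T S. K T S \<subseteq> C1 T \<and> real (card (K T S)) \<le> (1 + \<epsilon>) * N"
    "\<And>T I. I \<subseteq> C1 T \<Longrightarrow> \<forall>v\<in>I. nb v \<inter> I = {} \<Longrightarrow>
      \<exists>S\<subseteq>I. real (card S) * D2 \<le> real (card (C1 T)) \<and> I \<subseteq> S \<union> K T S"
    by metis
  define C2 where "C2 T S = K T S - S" for T S
  have C2: "C2 T S \<subseteq> V - T - S" "real (card (C2 T S)) \<le> (1 + \<epsilon>) * N" for T S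
  proof -
    have "card (C2 T S) \<le> card (K T S)"
      using K(1)[of T S] C1(1)[of T] finV unfolding C2_def
      by (intro card_mono) (auto intro: finite_subset)
    then show "real (card (C2 T S)) \<le> (1 + \<epsilon>) * N" using K(1)[of T S] by linarith
    show "C2 T S \<subseteq> V - T - S" using K(1)[of T S] C1(1)[of T] by (auto simp: C2_def)
  qed
  have fp: "\<exists>T S. T \<subseteq> I \<and> S \<subseteq> I \<and> S \<subseteq> C1 T \<and> I \<subseteq> T \<union> S \<union> C2 T S \<and>
      real (card T) \<le> 3456 * 2 ^ n / real n ^ 3 \<and> real (card S) \<le> 24 * (1 + \<epsilon>) * N / (\<epsilon> * real n)"
    if I: "I \<subseteq> V" "antichain I" for I
  proof -
    obtain T where T: "T \<subseteq> I" "real (card T) * D1 \<le> real (card V)" "I \<subseteq> T \<union> C T"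
      using C(2)[OF I(1) ind[OF I(2)]] by auto
    define J where "J = I - T"
    have J: "J \<subseteq> C1 T" "\<forall>v\<in>J. nb v \<inter> J = {}"
      using T(3) ind[OF I(2)] by (auto simp: J_def C1_def)
    obtain S where S: "S \<subseteq> J" "real (card S) * D2 \<le> real (card (C1 T))" "J \<subseteq> S \<union> K T S"
      using K(2)[OF J] by auto
    have "card V \<le> card (Pow U)" using assms(4) by (intro card_mono) (auto simp: V_def)
    then have "card V \<le> 2 ^ n" using assms(4) by (simp add: card_Pow n_def)
    then have "real (card V) \<le> 2 ^ n" by simp
    then have "real (card T) * D1 \<le> 2 ^ n" using T(2) by linarith
    then have "real (card T) \<le> 2 ^ n / D1" using D by (simp add: pos_le_divide_eq)
    then have "real (card T) \<le> 3456 * 2 ^ n / real n ^ 3" by (simp add: D1_def mult.commute)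
    moreover have "real (card S) \<le> 6 * N / D2"
      using S(2) C1(2)[of T] D by (simp add: pos_le_divide_eq)
    then have "real (card S) \<le> 24 * (1 + \<epsilon>) * N / (\<epsilon> * real n)" by (simp add: D2_def mult_ac)
    ultimately show ?thesis
      using T S J unfolding C2_def by (intro exI[of _ T] exI[of _ S]) (auto simp: J_def)
  qed
  show ?thesis using C1 C2 fp by (intro exI[of _ C1] exI[of _ C2]) simp
qed

subsection \<open>Random families containing a fingerprint\<close>

text \<open>Markov's inequality for the indicator of T \<subseteq> \<F> times the exponential moment
  of the count in \<open>C\<close>. The factor \<open>p ^ card T\<close> is what later pays for the
  union bound over fingerprints. Stating the event with \<open>l * a\<close> covers both tails: the
  upper one for \<open>l > 0\<close>, the lower one for \<open>l < 0\<close>.\<close>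

lemma prob_fingerprint:
  fixes p l a :: real
  assumes p: "p \<in> {0..1}" and sub: "T \<subseteq> Pow {1..n}" "C \<subseteq> Pow {1..n}" "T \<inter> C = {}"
  shows "measure_pmf.prob (random_family n p) {\<F>. T \<subseteq> \<F> \<and> l * a \<le> l * real (card (\<F> \<inter> C))}
    \<le> p ^ card T * exp (p * (exp l - 1) * real (card C) - l * a)"
proof -
  define P where "P = Pow {1..n}"
  define Q where "Q = Pi_pmf P False (\<lambda>_. bernoulli_pmf p)"
  define fam where "fam X = {A \<in> P. X A}" for X :: "nat set \<Rightarrow> bool"
  \<comment> \<open>One factor per set: the product \<open>u\<close> is the indicator of containing
    \<open>T\<close>, times exp l for each present member of \<open>C\<close>. Its expectation
    factorises by independence.\<close>
  define f :: "nat set \<Rightarrow> bool \<Rightarrow> real" where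
    "f A b = (if A \<in> T then of_bool b else if A \<in> C \<and> b then exp l else 1)" for A b
  define u where "u X = (\<Prod>A\<in>P. f A (X A))" for X
  have finP: "finite P" by (simp add: P_def)
  have finTC: "finite T" "finite C" using sub by (auto intro: finite_subset)
  have "finite (set_pmf Q)"
    unfolding Q_def using finP by (simp add: set_Pi_pmf finite_PiE_dflt)
  then have int: "integrable (measure_pmf Q) u" by (rule integrable_measure_pmf_finite)
  have f0: "f A b \<ge> 0" for A b by (simp add: f_def)
  then have u0: "u X \<ge> 0" for X by (simp add: u_def prod_nonneg)
  have "measure_pmf.expectation Q u = (\<Prod>A\<in>P. measure_pmf.expectation (bernoulli_pmf p) (f A))"
    unfolding Q_def u_def
    by (intro expectation_prod_Pi_pmf finP f0 integrable_measure_pmf_finite) auto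
  also have "\<dots> = (\<Prod>A\<in>P. (if A \<in> T then p else 1) * (if A \<in> C then 1 + p * (exp l - 1) else 1))"
    using p sub(3) by (intro prod.cong refl) (auto simp: f_def algebra_simps)
  also have "\<dots> = p ^ card T * (1 + p * (exp l - 1)) ^ card C"
    using sub finP by (simp add: prod.distrib prod.If_cases P_def Int_absorb1 Int_absorb2)
  also have "\<dots> \<le> p ^ card T * exp (p * (exp l - 1)) ^ card C"
  proof -
    \<comment> \<open>Rewritten as a convex combination to see that the base is nonnegative, also
      for negative \<open>l\<close>.\<close>
    have "1 + p * (exp l - 1) = (1 - p) + p * exp l" by (simp add: algebra_simps)
    also have "\<dots> \<ge> 0" using p by simp
    finally show ?thesis using p by (intro mult_left_mono power_mono) auto
  qed
  also have "\<dots> = p ^ card T * exp (p * (exp l - 1) * real (card C))"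
    by (simp add: exp_of_nat_mult[symmetric] mult_ac)
  finally have E: "measure_pmf.expectation Q u \<le> p ^ card T * exp (p * (exp l - 1) * real (card C))" .
  have "u X \<ge> exp (l * a)" if X: "T \<subseteq> fam X" "l * a \<le> l * real (card (fam X \<inter> C))" for X
  proof -
    have "u X = (\<Prod>A\<in>P. if A \<in> fam X \<inter> C then exp l else 1)"
      unfolding u_def using X(1) sub by (intro prod.cong refl) (auto simp: f_def fam_def)
    also have "\<dots> = exp l ^ card (fam X \<inter> C)"
      using finP sub(2) by (simp add: prod.If_cases P_def Int_absorb1 Int_assoc[symmetric] fam_def Int_def)
    also have "\<dots> = exp (l * real (card (fam X \<inter> C)))"
      by (simp add: exp_of_nat_mult[symmetric] mult_ac)
    finally show ?thesis using X(2) by simp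
  qed
  then have "measure_pmf.prob (random_family n p) {\<F>. T \<subseteq> \<F> \<and> l * a \<le> l * real (card (\<F> \<inter> C))}
      \<le> measure_pmf.prob Q {X \<in> space (measure_pmf Q). u X \<ge> exp (l * a)}"
    unfolding random_family_def measure_map_pmf Q_def[unfolded P_def, symmetric]
    by (intro measure_pmf.finite_measure_mono) (auto simp: fam_def P_def)
  also have "\<dots> \<le> measure_pmf.expectation Q u / exp (l * a)"
    by (intro integral_Markov_inequality_measure[of _ _ "{}"] int) (auto simp: u0)
  also have "\<dots> \<le> p ^ card T * exp (p * (exp l - 1) * real (card C)) / exp (l * a)"
    by (intro divide_right_mono E) simp
  finally show ?thesis by (simp add: exp_diff)
qed

section \<open>Total weight of small fingerprints\<close>

lemma sum_power_card_Pow: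
  fixes x :: real
  assumes "finite V"
  shows "(\<Sum>T\<in>Pow V. x ^ card T) = (1 + x) ^ card V"
  using prod_add[OF assms, of "\<lambda>_. x" "\<lambda>_. 1"] by (simp add: add.commute)

text \<open>Exponential tilting: since 1 / x \<le> exp (1 / x), each subset of size at most
  \<open>m\<close> has weight at most exp (m / x) (x p)^|T|. The tilted weights are then summed over
  all subsets by the binomial theorem. A small \<open>x\<close> makes the term in
  \<open>card V\<close> cheap, at the price of the term \<open>m / x\<close>.\<close>

lemma sum_power_card_small_subsets:
  fixes p x m :: real
  assumes "finite V" "p \<ge> 0" "0 < x"
  shows "(\<Sum>T | T \<subseteq> V \<and> real (card T) \<le> m. p ^ card T) \<le> exp (m / x + x * p * real (card V))"
proof -
  have "(\<Sum>T | T \<subseteq> V \<and> real (card T) \<le> m. p ^ card T)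
      \<le> (\<Sum>T | T \<subseteq> V \<and> real (card T) \<le> m. exp (m / x) * (x * p) ^ card T)"
  proof (rule sum_mono)
    fix T assume T: "T \<in> {T. T \<subseteq> V \<and> real (card T) \<le> m}"
    have "1 / x \<le> exp (1 / x)" using exp_ge_add_one_self[of "1 / x"] by linarith
    then have "(1 / x) ^ card T \<le> exp (1 / x) ^ card T"
      using assms(3) by (intro power_mono) auto
    also have "\<dots> = exp (real (card T) / x)" by (simp add: exp_of_nat_mult[symmetric])
    also have "\<dots> \<le> exp (m / x)" using T assms(3) by (simp add: divide_right_mono)
    finally have "(1 / x) ^ card T * (x * p) ^ card T \<le> exp (m / x) * (x * p) ^ card T"
      using assms by (intro mult_right_mono) auto
    then show "p ^ card T \<le> exp (m / x) * (x * p) ^ card T"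
      using assms(3) by (simp add: power_mult_distrib[symmetric])
  qed
  also have "\<dots> \<le> (\<Sum>T\<in>Pow V. exp (m / x) * (x * p) ^ card T)"
    using assms by (intro sum_mono2) auto
  also have "\<dots> = exp (m / x) * (1 + x * p) ^ card V"
    using assms(1) by (simp add: sum_distrib_left[symmetric] sum_power_card_Pow)
  also have "\<dots> \<le> exp (m / x) * exp (x * p) ^ card V"
    using assms by (intro mult_left_mono power_mono) auto
  finally show ?thesis by (simp add: exp_add exp_of_nat_mult[symmetric] mult_ac)
qed

lemma two_power_le_central_binomial: "2 ^ n \<le> (real n + 1) * real (n choose (n div 2))"
proof -
  have "2 ^ n = (\<Sum>k\<le>n. real (n choose k))"
    by (simp add: choose_row_sum[symmetric] flip: of_nat_sum)
  also have "\<dots> \<le> (\<Sum>k\<le>n. real (n choose (n div 2)))"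
    by (intro sum_mono of_nat_mono binomial_maximum)
  finally show ?thesis by (simp add: add.commute)
qed

subsection \<open>Antichains in the random family\<close>

text \<open>Union bound over the fingerprint pairs \<open>(T, S)\<close>. The sum over
  \<open>T\<close> costs \<open>m1 * (real n + 1) / x + x * p * N\<close>, the sum over
  \<open>S\<close> costs \<open>m2 / x + 6 * x * p * N\<close>, and the remaining terms are the
  exponential moment bound for one container.\<close>

lemma prob_large_antichain_in_middle:
  fixes p x l a \<epsilon> :: real and n :: nat
  defines "N \<equiv> real (n choose (n div 2))"
    and "V \<equiv> {A \<in> Pow {1..n}. 4 * card A < 3 * n}"
  defines "m1 \<equiv> 3456 * 2 ^ n / real n ^ 3" and "m2 \<equiv> 24 * (1 + \<epsilon>) * N / (\<epsilon> * real n)"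
  assumes p: "p \<in> {0..1}" and n: "n \<ge> 12" and pos: "\<epsilon> > 0" "x > 0" "l \<ge> 0"
  shows "measure_pmf.prob (random_family n p) {\<F>. \<exists>I\<subseteq>\<F> \<inter> V. antichain I \<and> a \<le> real (card I)}
    \<le> exp (m1 * (real n + 1) / x + m2 / x + 7 * x * p * N + p * (exp l - 1) * (1 + \<epsilon>) * N - l * (a - m1 - m2))"
proof -
  define U where "U = {1..n}"
  have cU: "card U = n" "finite U" by (auto simp: U_def)
  have V: "V = {A \<in> Pow U. 4 * card A < 3 * n}" by (simp add: V_def U_def)
  obtain C1 C2 where C1': "\<forall>T. C1 T \<subseteq> V - T \<and> real (card (C1 T)) \<le> 6 * N"
    and C2': "\<forall>T S. C2 T S \<subseteq> V - T - S \<and> real (card (C2 T S)) \<le> (1 + \<epsilon>) * N"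
    and fp: "\<forall>I\<subseteq>V. antichain I \<longrightarrow> (\<exists>T S. T \<subseteq> I \<and> S \<subseteq> I \<and> S \<subseteq> C1 T \<and> I \<subseteq> T \<union> S \<union> C2 T S \<and>
      real (card T) \<le> m1 \<and> real (card S) \<le> m2)"
    using antichain_containers[of U \<epsilon>, unfolded cU(1), folded N_def, folded V m1_def m2_def,
        OF cU(2) n pos(1)] by (elim exE conjE)
  note C1 = C1'[rule_format, THEN conjunct1] C1'[rule_format, THEN conjunct2]
  note C2 = C2'[rule_format, THEN conjunct1] C2'[rule_format, THEN conjunct2]
  have finV: "finite V" by (simp add: V_def)
  \<comment> \<open>The number of members of \<F> that the container must still supply once the
    fingerprints are discounted.\<close>
  define b where "b = a - m1 - m2"
  define \<T> where "\<T> = {T. T \<subseteq> V \<and> real (card T) \<le> m1}"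
  define \<S> where "\<S> T = {S. S \<subseteq> C1 T \<and> real (card S) \<le> m2}" for T
  define M where "M = measure_pmf.prob (random_family n p)"
  define Ev where "Ev T S = {\<F>. T \<union> S \<subseteq> \<F> \<and> l * b \<le> l * real (card (\<F> \<inter> C2 T S))}" for T S
  have finT: "finite \<T>" using finV by (simp add: \<T>_def)
  have finC1: "finite (C1 T)" for T using C1(1)[of T] finV by (auto dest: finite_subset)
  have finS: "finite (\<S> T)" for T using finC1 by (simp add: \<S>_def)
  define q where "q = exp (p * (exp l - 1) * ((1 + \<epsilon>) * N) - l * b)"
  have single: "M (Ev T S) \<le> p ^ card T * p ^ card S * q" if "T \<in> \<T>" "S \<in> \<S> T" for T S
  proof -
    have "finite T" "finite S" "T \<inter> S = {}"
      using that C1(1)[of T] finV finC1[of T] by (auto simp: \<T>_def \<S>_def dest: finite_subset)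
    then have card: "card (T \<union> S) = card T + card S" by (rule card_Un_disjoint)
    have "V \<subseteq> Pow {1..n}" "T \<subseteq> V" "S \<subseteq> V"
      using that C1(1)[of T] by (auto simp: V_def \<T>_def \<S>_def)
    then have "M (Ev T S) \<le> p ^ card (T \<union> S) * exp (p * (exp l - 1) * real (card (C2 T S)) - l * b)"
      unfolding M_def Ev_def using C2(1)[of T S] by (intro prob_fingerprint p) blast+
    also have "\<dots> \<le> p ^ card (T \<union> S) * q"
      unfolding q_def using p pos C2(2)[of T S]
      by (intro mult_left_mono) (auto intro!: mult_left_mono)
    finally show ?thesis by (simp add: card power_add)
  qed
  have "{\<F>. \<exists>I\<subseteq>\<F> \<inter> V. antichain I \<and> a \<le> real (card I)} \<subseteq> (\<Union>(T, S)\<in>Sigma \<T> \<S>. Ev T S)"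
  proof clarify
    fix \<F> I assume I: "I \<subseteq> \<F> \<inter> V" "antichain I" "a \<le> real (card I)"
    obtain T S where TS: "T \<subseteq> I" "S \<subseteq> I" "S \<subseteq> C1 T" "I \<subseteq> T \<union> S \<union> C2 T S"
      "real (card T) \<le> m1" "real (card S) \<le> m2"
      using fp I by (metis le_inf_iff)
    have finI: "finite I" using I(1) finV by (auto intro: finite_subset)
    have fin2: "finite (C2 T S)" using C2(1)[of T S] finV by (auto intro: finite_subset)
    have fTS: "finite T" "finite S" using TS finI by (auto intro: finite_subset)
    have "I \<subseteq> T \<union> S \<union> (\<F> \<inter> C2 T S)" using TS(4) I(1) by auto
    then have "card I \<le> card (T \<union> S \<union> (\<F> \<inter> C2 T S))"
      using fTS fin2 by (intro card_mono) auto
    also have "\<dots> \<le> card T + card S + card (\<F> \<inter> C2 T S)"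
      by (meson add_le_mono1 card_Un_le le_trans)
    finally have "b \<le> real (card (\<F> \<inter> C2 T S))" using TS I(3) by (simp add: b_def)
    then have "\<F> \<in> Ev T S" using TS I pos by (auto simp: Ev_def intro: mult_left_mono)
    moreover have "T \<in> \<T>" "S \<in> \<S> T" using TS I by (auto simp: \<T>_def \<S>_def)
    ultimately show "\<F> \<in> (\<Union>(T, S)\<in>Sigma \<T> \<S>. Ev T S)" by blast
  qed
  then have "M {\<F>. \<exists>I\<subseteq>\<F> \<inter> V. antichain I \<and> a \<le> real (card I)} \<le> M (\<Union>(T, S)\<in>Sigma \<T> \<S>. Ev T S)"
    unfolding M_def by (intro measure_pmf.finite_measure_mono) auto
  also have "\<dots> \<le> (\<Sum>(T, S)\<in>Sigma \<T> \<S>. M (Ev T S))"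
    unfolding M_def split_def
    by (intro measure_pmf.finite_measure_subadditive_finite) (auto simp: finT finS)
  also have "\<dots> = (\<Sum>T\<in>\<T>. \<Sum>S\<in>\<S> T. M (Ev T S))"
    using finT finS by (subst sum.Sigma) auto
  also have "\<dots> \<le> (\<Sum>T\<in>\<T>. \<Sum>S\<in>\<S> T. p ^ card T * p ^ card S * q)"
    by (intro sum_mono single)
  also have "\<dots> = (\<Sum>T\<in>\<T>. p ^ card T * ((\<Sum>S\<in>\<S> T. p ^ card S) * q))"
    by (simp add: sum_distrib_left sum_distrib_right mult.assoc)
  also have "\<dots> \<le> (\<Sum>T\<in>\<T>. p ^ card T * (exp (m2 / x + x * p * (6 * N)) * q))"
  proof (intro sum_mono mult_left_mono mult_right_mono)
    fix T
    have "(\<Sum>S\<in>\<S> T. p ^ card S) \<le> exp (m2 / x + x * p * real (card (C1 T)))"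
      unfolding \<S>_def using p pos finC1 by (intro sum_power_card_small_subsets) auto
    also have "\<dots> \<le> exp (m2 / x + x * p * (6 * N))"
      using C1(2)[of T] p pos by (auto intro!: mult_left_mono)
    finally show "(\<Sum>S\<in>\<S> T. p ^ card S) \<le> exp (m2 / x + x * p * (6 * N))" .
  qed (use p in \<open>auto simp: q_def\<close>)
  also have "\<dots> = (\<Sum>T\<in>\<T>. p ^ card T) * (exp (m2 / x + x * p * (6 * N)) * q)"
    by (simp add: sum_distrib_right)
  also have "\<dots> \<le> exp (m1 * (real n + 1) / x + x * p * N) * (exp (m2 / x + x * p * (6 * N)) * q)"
  proof (intro mult_right_mono)
    \<comment> \<open>\<open>y\<close> absorbs the factor \<open>n + 1\<close> in \<open>card V \<le> (n + 1) * N\<close>; this is affordable since \<open>m1\<close> is so small\<close>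
    define y where "y = x / (real n + 1)"
    have y: "y > 0" using pos by (simp add: y_def)
    have "card V \<le> card (Pow {1..n})" by (intro card_mono) (auto simp: V_def)
    then have "card V \<le> 2 ^ n" by (simp add: card_Pow)
    then have "real (card V) \<le> 2 ^ n" by simp
    then have cV: "real (card V) \<le> (real n + 1) * N"
      using two_power_le_central_binomial[of n] unfolding N_def by linarith
    have "(\<Sum>T\<in>\<T>. p ^ card T) \<le> exp (m1 / y + y * p * real (card V))"
      unfolding \<T>_def using p y finV by (intro sum_power_card_small_subsets) auto
    also have "\<dots> \<le> exp (m1 / y + y * p * ((real n + 1) * N))"
      using cV p y by (auto intro!: mult_left_mono)
    also have "m1 / y + y * p * ((real n + 1) * N) = m1 * (real n + 1) / x + x * p * N"
      using pos by (simp add: y_def)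
    finally show "(\<Sum>T\<in>\<T>. p ^ card T) \<le> exp (m1 * (real n + 1) / x + x * p * N)" .
  qed (auto simp: q_def)
  also have "\<dots> = exp (m1 * (real n + 1) / x + m2 / x + 7 * x * p * N
      + p * (exp l - 1) * (1 + \<epsilon>) * N - l * (a - m1 - m2))"
    unfolding q_def b_def exp_add[symmetric] by (intro arg_cong[of _ _ exp]) (simp add: algebra_simps)
  finally show ?thesis by (simp add: M_def)
qed

lemma central_binomial_ge: "n \<ge> 1 \<Longrightarrow> n \<le> n choose (n div 2)"
  using binomial_maximum[of n 1] by simp

text \<open>With \<open>W\<close> = p N, the exponential moment estimate gains l \<epsilon> W. The
  tilting terms use up half of this and the fingerprint terms a quarter, which leaves
  \<open>c * W\<close>.\<close>

lemma eventually_prob_large_antichain_in_middle: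
  fixes p :: "nat \<Rightarrow> real" and \<epsilon> :: real
  assumes p: "\<And>n. p n \<in> {0..1}" and lim: "filterlim (\<lambda>n. p n * real n) at_top sequentially"
    and \<epsilon>: "\<epsilon> > 0"
  shows "\<exists>c>0. \<forall>\<^sub>F n in sequentially. measure_pmf.prob (random_family n (p n))
    {\<F>. \<exists>I\<subseteq>\<F> \<inter> {A \<in> Pow {1..n}. 4 * card A < 3 * n}. antichain I \<and>
        (1 + 3 * \<epsilon>) * p n * real (n choose (n div 2)) \<le> real (card I)} \<le> exp (- c * (p n * real n))"
proof -
  \<comment> \<open>Chosen so that exp l - 1 \<le> l + l^2 gives (exp l - 1) (1 + \<epsilon>) \<le>
    l (1 + \<epsilon>) + l \<epsilon>. Then \<open>x\<close> makes 7 x equal to l \<epsilon> / 2,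
    and \<open>K\<close> collects the constants of all fingerprint terms.\<close>
  define l where "l = \<epsilon> / (1 + \<epsilon>)"
  define x where "x = l * \<epsilon> / 14"
  define K where "K = (13824 + 24 * (1 + \<epsilon>) / \<epsilon>) * (1 / x + l)"
  have l: "0 < l" "l \<le> 1" "l * (1 + \<epsilon>) = \<epsilon>" using \<epsilon> by (auto simp: l_def)
  have x: "0 < x" using \<epsilon> l by (simp add: x_def)
  have K: "K > 0" using \<epsilon> l x by (auto simp: K_def intro!: mult_pos_pos add_pos_pos)
  define c where "c = l * \<epsilon> / 4"
  have c: "c > 0" using \<epsilon> l by (simp add: c_def)
  have ev: "\<forall>\<^sub>F n in sequentially. p n * real n \<ge> K / c"
    using lim by (simp add: filterlim_at_top)
  have "\<forall>\<^sub>F n in sequentially. measure_pmf.prob (random_family n (p n))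
    {\<F>. \<exists>I\<subseteq>\<F> \<inter> {A \<in> Pow {1..n}. 4 * card A < 3 * n}. antichain I \<and>
        (1 + 3 * \<epsilon>) * p n * real (n choose (n div 2)) \<le> real (card I)} \<le> exp (- c * (p n * real n))"
    using ev eventually_ge_at_top[of 12]
  proof eventually_elim
    case (elim n)
    define N where "N = real (n choose (n div 2))"
    define W where "W = p n * N"
    define m1 where "m1 = 3456 * 2 ^ n / real n ^ 3"
    define m2 where "m2 = 24 * (1 + \<epsilon>) * N / (\<epsilon> * real n)"
    have n0: "real n \<ge> 12" using elim by simp
    have pn: "0 \<le> p n" using p[of n] by simp
    have Nn: "real n \<le> N" unfolding N_def using central_binomial_ge[of n] elim by simp
    have W: "p n * real n \<le> W" "0 \<le> W" unfolding W_def using Nn pn by (auto intro: mult_left_mono)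
    \<comment> \<open>The fingerprint terms are of order N / n, and the divergence of p n makes this
      a small fraction of p N.\<close>
    have NW: "K * (N / real n) \<le> c * W"
    proof -
      have "K \<le> c * (p n * real n)" using elim(1) c by (simp add: field_simps)
      then have "K * (N / real n) \<le> c * (p n * real n) * (N / real n)"
        using Nn n0 by (intro mult_right_mono) auto
      also have "\<dots> = c * W" using n0 by (simp add: W_def)
      finally show ?thesis .
    qed
    \<comment> \<open>The constant is 4 * 3456, from bounding \<open>real n + 1\<close> by
      \<open>2 * real n\<close> twice.\<close>
    have m1n: "m1 * (real n + 1) \<le> 13824 * (N / real n)"
    proof -
      have "m1 * (real n + 1) \<le> 3456 * ((real n + 1) * N) / real n ^ 3 * (real n + 1)"
        unfolding m1_def N_def using two_power_le_central_binomial[of n] n0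
        by (intro mult_right_mono divide_right_mono mult_left_mono) auto
      also have "\<dots> = 3456 * N * ((real n + 1) * (real n + 1)) / real n ^ 3" by (simp add: mult_ac)
      also have "\<dots> \<le> 3456 * N * ((2 * real n) * (2 * real n)) / real n ^ 3"
        using n0 Nn by (intro divide_right_mono mult_left_mono mult_mono) auto
      also have "\<dots> = 13824 * (N / real n)" using n0 by (simp add: field_simps power3_eq_cube)
      finally show ?thesis .
    qed
    have m10: "m1 \<ge> 0" by (simp add: m1_def)
    then have m1: "m1 \<le> 13824 * (N / real n)"
      using m1n n0 mult_left_mono[of 1 "real n + 1" m1] by linarith
    have m2: "m2 = 24 * (1 + \<epsilon>) / \<epsilon> * (N / real n)" by (simp add: m2_def)
    have small: "(m1 * (real n + 1) + m2) / x + l * (m1 + m2) \<le> c * W"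
    proof -
      have "(m1 * (real n + 1) + m2) / x + l * (m1 + m2)
          \<le> (13824 * (N / real n) + m2) / x + l * (13824 * (N / real n) + m2)"
        using m1 m1n x l by (intro add_mono divide_right_mono mult_left_mono) auto
      also have "\<dots> = K * (N / real n)" by (simp add: K_def m2 algebra_simps add_divide_distrib)
      finally show ?thesis using NW by linarith
    qed
    have "exp l - 1 \<le> l + l\<^sup>2" using exp_bound[of l] l by simp
    then have "p n * (exp l - 1) * (1 + \<epsilon>) * N \<le> p n * (l + l\<^sup>2) * (1 + \<epsilon>) * N"
      using pn \<epsilon> Nn by (intro mult_right_mono mult_left_mono) auto
    also have "\<dots> = W * (l * (1 + \<epsilon>) + l * (l * (1 + \<epsilon>)))"
      by (simp add: W_def power2_eq_square algebra_simps)
    also have "\<dots> = W * (\<epsilon> + l * \<epsilon>)" by (simp add: l)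
    finally have main: "p n * (exp l - 1) * (1 + \<epsilon>) * N \<le> W * (l * (1 + \<epsilon>) + l * \<epsilon>)" by (simp add: l)
    have "measure_pmf.prob (random_family n (p n))
      {\<F>. \<exists>I\<subseteq>\<F> \<inter> {A \<in> Pow {1..n}. 4 * card A < 3 * n}. antichain I \<and> (1 + 3 * \<epsilon>) * W \<le> real (card I)}
      \<le> exp (m1 * (real n + 1) / x + m2 / x + 7 * x * p n * N + p n * (exp l - 1) * (1 + \<epsilon>) * N
          - l * ((1 + 3 * \<epsilon>) * W - m1 - m2))"
      unfolding N_def m1_def m2_def
      by (rule prob_large_antichain_in_middle) (use p[of n] elim \<epsilon> x l in auto)
    also have "\<dots> \<le> exp (- c * (p n * real n))"
    proof -
      have "m1 * (real n + 1) / x + m2 / x + 7 * x * p n * N + p n * (exp l - 1) * (1 + \<epsilon>) * N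
          - l * ((1 + 3 * \<epsilon>) * W - m1 - m2)
          = ((m1 * (real n + 1) + m2) / x + l * (m1 + m2)) + 7 * x * W
            + (p n * (exp l - 1) * (1 + \<epsilon>) * N - l * (1 + 3 * \<epsilon>) * W)"
        by (simp add: algebra_simps add_divide_distrib W_def)
      also have "\<dots> \<le> c * W + 7 * x * W + (W * (l * (1 + \<epsilon>) + l * \<epsilon>) - l * (1 + 3 * \<epsilon>) * W)"
        using small main by linarith
      also have "\<dots> = - c * W" by (simp add: c_def x_def algebra_simps)
      also have "\<dots> \<le> - c * (p n * real n)" using W c by simp
      finally show ?thesis by simp
    qed
    finally show ?case by (simp add: W_def N_def mult.assoc)
  qed
  with c show ?thesis by blast
qed

subsection \<open>Binomial asymptotics and middle layers\<close>

text \<open>Weighting each set by 2^|A| gives total weight 3^n. Every set counted here has weight at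
  least 2^(3n/4), which is at least (5/3)^n because (5/3)^4 < 8. Hence there are at most (9/5)^n of
  them, exponentially fewer than 2^n / (n + 1).\<close>

lemma eventually_card_above_middle_le:
  fixes \<delta> :: real
  assumes "\<delta> > 0"
  shows "\<forall>\<^sub>F n in sequentially.
    real (card {A \<in> Pow {1..n}. \<not> 4 * card A < 3 * n}) \<le> \<delta> * real (n choose (n div 2))"
proof -
  have "(\<lambda>n. real n * (9/10) ^ n + (9/10 :: real) ^ n) \<longlonglongrightarrow> 0 + 0"
    by (intro tendsto_add powser_times_n_limit_0 LIMSEQ_realpow_zero) auto
  then have "\<forall>\<^sub>F n in sequentially. real n * (9/10) ^ n + (9/10 :: real) ^ n < \<delta>"
    using assms by (simp add: order_tendsto_iff)
  then show ?thesis
  proof eventually_elim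
    case (elim n)
    define O' where "O' = {A \<in> Pow {1..n}. \<not> 4 * card A < 3 * n}"
    define N where "N = real (n choose (n div 2))"
    have "real (card O') * (5/3) ^ n = (\<Sum>A\<in>O'. (5/3) ^ n)" by simp
    also have "\<dots> \<le> (\<Sum>A\<in>O'. 2 ^ card A)"
    proof (rule sum_mono)
      fix A assume A: "A \<in> O'"
      have "((5/3) ^ n) ^ 4 = ((5/3 :: real) ^ 4) ^ n" by (simp add: power_mult[symmetric] mult.commute)
      also have "\<dots> \<le> (2 ^ 3) ^ n" by (intro power_mono) (auto simp: power_divide)
      also have "\<dots> = 2 ^ (3 * n)" by (simp add: power_mult)
      also have "\<dots> \<le> 2 ^ (4 * card A)" using A by (intro power_increasing) (auto simp: O'_def)
      also have "\<dots> = (2 ^ card A) ^ 4" by (simp add: power_mult[symmetric] mult.commute)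
      finally show "(5/3 :: real) ^ n \<le> 2 ^ card A" by (subst (asm) power_mono_iff) auto
    qed
    also have "\<dots> \<le> (\<Sum>A\<in>Pow {1..n}. 2 ^ card A)"
      by (intro sum_mono2) (auto simp: O'_def)
    also have "\<dots> = (3 :: real) ^ n" by (simp add: sum_power_card_Pow)
    finally have "real (card O') \<le> 3 ^ n / (5/3) ^ n" by (simp add: pos_le_divide_eq)
    also have "\<dots> = (9/10) ^ n * 2 ^ n" by (simp add: power_divide[symmetric] power_mult_distrib[symmetric])
    also have "\<dots> \<le> (9/10) ^ n * ((real n + 1) * N)"
      unfolding N_def by (intro mult_left_mono two_power_le_central_binomial) auto
    also have "\<dots> = (real n * (9/10) ^ n + (9/10) ^ n) * N" by (simp add: algebra_simps)
    also have "\<dots> \<le> \<delta> * N" using elim by (intro mult_right_mono) (auto simp: N_def)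
    finally show ?case by (simp add: O'_def N_def)
  qed
qed

text \<open>Consecutive coefficients at levels m and m + 1 have ratio (n - m) / (m + 1), which tends
  to 1 at any fixed distance from the centre.\<close>

lemma near_central_binomial_tendsto:
  "(\<lambda>n. real (n choose (n div 2 + i)) / real (n choose (n div 2))) \<longlonglongrightarrow> 1"
proof (induction i)
  case 0
  have "n div 2 \<le> n" for n :: nat by simp
  then show ?case by (simp add: leD)
next
  case (Suc i)
  define m where "m n = n div 2 + i" for n
  define q where "q n = (real n - real (m n)) / (real (m n) + 1)" for n
  have "(\<lambda>n. q n - 1) \<longlonglongrightarrow> 0"
  proof (rule Lim_null_comparison)
    show "\<forall>\<^sub>F n in sequentially. norm (q n - 1) \<le> (2 * (2 * real i + 1)) / real n"
      using eventually_gt_at_top[of 0]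
    proof eventually_elim
      case (elim n)
      define h where "h = n div 2"
      have h: "2 * real h \<le> real n" "real n \<le> 2 * real h + 1" unfolding h_def by linarith+
      have "q n - 1 = (real n - 2 * real h - 2 * real i - 1) / (real (m n) + 1)"
        by (simp add: q_def m_def h_def field_simps)
      then have "norm (q n - 1) = \<bar>real n - 2 * real h - 2 * real i - 1\<bar> / (real (m n) + 1)" by simp
      also have "\<dots> \<le> (2 * real i + 1) / (real n / 2)"
        using h elim by (intro frac_le) (auto simp: m_def h_def)
      finally show ?case by (simp add: mult.commute)
    qed
    show "(\<lambda>n. 2 * (2 * real i + 1) / real n) \<longlonglongrightarrow> 0" by (rule lim_const_over_n)
  qed
  then have "(\<lambda>n. q n) \<longlonglongrightarrow> 1" by (simp add: LIM_zero_iff)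
  from tendsto_mult[OF Suc.IH this]
  have "(\<lambda>n. real (n choose (n div 2 + i)) / real (n choose (n div 2)) * q n) \<longlonglongrightarrow> 1" by simp
  moreover have "\<forall>\<^sub>F n in sequentially.
      real (n choose (n div 2 + i)) / real (n choose (n div 2)) * q n
      = real (n choose (n div 2 + Suc i)) / real (n choose (n div 2))"
    using eventually_ge_at_top[of "2 * i + 2"]
  proof eventually_elim
    case (elim n)
    have le: "m n \<le> n" using elim by (simp add: m_def)
    have "Suc (m n) * (n choose Suc (m n)) = (n - m n) * (n choose m n)"
      using binomial_absorption[of "m n" "n"] binomial_absorb_comp[of n "m n"] by simp
    then have "real (Suc (m n) * (n choose Suc (m n))) = real ((n - m n) * (n choose m n))" by simp
    then have "(real (m n) + 1) * real (n choose Suc (m n)) = (real n - real (m n)) * real (n choose m n)"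
      using le by (simp add: of_nat_diff algebra_simps)
    then have "real (n choose Suc (m n)) = real (n choose m n) * q n"
      by (simp add: q_def field_simps)
    then show ?case by (simp add: m_def)
  qed
  ultimately show ?case by (rule Lim_transform_eventually)
qed

lemma eventually_card_middle_layers_ge:
  fixes \<delta> :: real
  assumes "\<delta> > 0"
  shows "\<forall>\<^sub>F n in sequentially. (real r - \<delta>) * real (n choose (n div 2))
    \<le> real (card {A \<in> Pow {1..n}. card A \<in> {n div 2..<n div 2 + r}})"
proof -
  have "(\<lambda>n. \<Sum>i<r. real (n choose (n div 2 + i)) / real (n choose (n div 2))) \<longlonglongrightarrow> (\<Sum>i<r. 1)"
    by (intro tendsto_sum near_central_binomial_tendsto)
  then have "\<forall>\<^sub>F n in sequentially.
      real r - \<delta> < (\<Sum>i<r. real (n choose (n div 2 + i)) / real (n choose (n div 2)))"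
    using assms by (intro order_tendstoD(1)) auto
  then show ?thesis
  proof eventually_elim
    case (elim n)
    define h where "h = n div 2"
    have pos: "real (n choose h) > 0" by (simp add: h_def)
    have "{h..<h + r} = (+) h ` {..<r}" by (simp add: lessThan_atLeast0 add.commute)
    then have "{A \<in> Pow {1..n}. card A \<in> {h..<h + r}} = (\<Union>i\<in>{..<r}. {A. A \<subseteq> {1..n} \<and> card A = h + i})"
      by blast
    also have "card \<dots> = (\<Sum>i<r. card {A. A \<subseteq> {1..n} \<and> card A = h + i})"
      by (intro card_UN_disjoint) auto
    also have "\<dots> = (\<Sum>i<r. n choose (h + i))" by (simp add: n_subsets)
    finally have "real (card {A \<in> Pow {1..n}. card A \<in> {h..<h + r}}) = (\<Sum>i<r. real (n choose (h + i)))"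
      by simp
    moreover have "(real r - \<delta>) < (\<Sum>i<r. real (n choose (h + i))) / real (n choose h)"
      using elim by (simp add: h_def sum_divide_distrib)
    ultimately show ?case using pos by (simp add: h_def pos_less_divide_eq)
  qed
qed

section \<open>Chain-free families and the extremal number\<close>

text \<open>Along a chain of \<open>k\<close> finite sets the size drops by at least
  \<open>k - 1\<close>, while two sizes in the given range differ by at most
  \<open>k - 2\<close>.\<close>

lemma k_chain_free_of_card_range:
  assumes "\<And>A. A \<in> \<A> \<Longrightarrow> finite A \<and> card A \<in> {m..<m + (k - 1)}" and "k \<ge> 1"
  shows "k_chain_free k \<A>"
  unfolding k_chain_free_def
proof (intro notI, elim exE conjE)
  fix C assume C: "C \<subseteq> \<A>" "is_k_chain k C"
  then obtain F where F: "C = F ` {1..k}" "\<forall>i\<in>{1..<k}. F (Suc i) \<subset> F i"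
    unfolding is_k_chain_def by blast
  have mem: "F i \<in> \<A>" if "1 \<le> i" "i \<le> k" for i using that C(1) F(1) by auto
  have "card (F (Suc j)) + j \<le> card (F 1)" if "j < k" for j
    using that
  proof (induction j)
    case (Suc j)
    have "finite (F (Suc j))" using mem[of "Suc j"] assms(1) Suc.prems by auto
    then have "card (F (Suc (Suc j))) < card (F (Suc j))"
      using F(2) Suc.prems by (intro psubset_card_mono) auto
    then show ?case using Suc by simp
  qed simp
  from this[of "k - 1"] assms(2) have "card (F k) + (k - 1) \<le> card (F 1)" by simp
  moreover have "card (F 1) < m + (k - 1)" "m \<le> card (F k)"
    using assms(1)[OF mem[of 1]] assms(1)[OF mem[of k]] assms(2) by auto
  ultimately show False by linarith
qed

lemma max_k_chain_free_bounds:
  assumes "finite \<F>" "k \<ge> 1"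
  shows "\<And>\<A>. \<A> \<subseteq> \<F> \<Longrightarrow> k_chain_free k \<A> \<Longrightarrow> card \<A> \<le> max_k_chain_free k \<F>"
    and "\<exists>\<A>\<subseteq>\<F>. k_chain_free k \<A> \<and> card \<A> = max_k_chain_free k \<F>"
proof -
  let ?S = "{card \<A> |\<A>. \<A> \<subseteq> \<F> \<and> k_chain_free k \<A>}"
  have fin: "finite ?S" using assms(1) by (auto simp: setcompr_eq_image intro!: finite_imageI)
  show "card \<A> \<le> max_k_chain_free k \<F>" if "\<A> \<subseteq> \<F>" "k_chain_free k \<A>" for \<A>
    unfolding max_k_chain_free_def using fin that by (intro Max_ge) auto
  have "k_chain_free k ({} :: 'a set set)"
    using assms(2) by (auto simp: k_chain_free_def is_k_chain_def)
  then have "?S \<noteq> {}" by blast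
  from Max_in[OF fin this] show "\<exists>\<A>\<subseteq>\<F>. k_chain_free k \<A> \<and> card \<A> = max_k_chain_free k \<F>"
    unfolding max_k_chain_free_def by auto
qed

lemma set_pmf_random_family: "\<F> \<in> set_pmf (random_family n p) \<Longrightarrow> \<F> \<subseteq> Pow {1..n}"
  by (auto simp: random_family_def)

subsection \<open>Concentration of the extremal number\<close>

text \<open>The antichain is split at 3n/4 elements. The extra \<epsilon> in the threshold absorbs
  every member of \<F> in the upper part, which is controlled by the exponential moment bound with
  empty fingerprint and l = 1. The condition \<F> \<subseteq> Pow {1..n} in the event ensures that
  the two parts cover the antichain.\<close>

lemma eventually_prob_large_antichain:
  fixes p :: "nat \<Rightarrow> real" and \<epsilon> :: real
  assumes p: "\<And>n. p n \<in> {0..1}" and lim: "filterlim (\<lambda>n. p n * real n) at_top sequentially"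
    and \<epsilon>: "\<epsilon> > 0"
  shows "\<exists>c>0. \<forall>\<^sub>F n in sequentially. measure_pmf.prob (random_family n (p n))
    {\<F>. \<F> \<subseteq> Pow {1..n} \<and> (\<exists>I\<subseteq>\<F>. antichain I \<and>
        (1 + 4 * \<epsilon>) * p n * real (n choose (n div 2)) \<le> real (card I))} \<le> 2 * exp (- c * (p n * real n))"
proof -
  define V where "V n = {A \<in> Pow {1..n}. 4 * card A < 3 * n}" for n
  define O' where "O' n = {A \<in> Pow {1..n}. \<not> 4 * card A < 3 * n}" for n
  define W where "W n = p n * real (n choose (n div 2))" for n
  obtain c1 where c1: "c1 > 0" and ev1: "\<forall>\<^sub>F n in sequentially. measure_pmf.prob (random_family n (p n))
    {\<F>. \<exists>I\<subseteq>\<F> \<inter> V n. antichain I \<and> (1 + 3 * \<epsilon>) * W n \<le> real (card I)} \<le> exp (- c1 * (p n * real n))"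
    using eventually_prob_large_antichain_in_middle[OF p lim \<epsilon>]
    by (auto simp: V_def W_def mult.assoc)
  define c where "c = min c1 (\<epsilon> / 2)"
  have c: "c > 0" "c \<le> c1" "c \<le> \<epsilon> / 2" using c1 \<epsilon> by (auto simp: c_def)
  have ev2: "\<forall>\<^sub>F n in sequentially. real (card (O' n)) \<le> \<epsilon> / 4 * real (n choose (n div 2))"
    unfolding O'_def using \<epsilon> by (intro eventually_card_above_middle_le) simp
  have "\<forall>\<^sub>F n in sequentially. measure_pmf.prob (random_family n (p n))
    {\<F>. \<F> \<subseteq> Pow {1..n} \<and> (\<exists>I\<subseteq>\<F>. antichain I \<and> (1 + 4 * \<epsilon>) * W n \<le> real (card I))}
    \<le> 2 * exp (- c * (p n * real n))"
    using ev1 ev2 eventually_ge_at_top[of 1]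
  proof eventually_elim
    case (elim n)
    let ?M = "random_family n (p n)"
    let ?B1 = "{\<F>. \<exists>I\<subseteq>\<F> \<inter> V n. antichain I \<and> (1 + 3 * \<epsilon>) * W n \<le> real (card I)}"
    let ?B2 = "{\<F>. {} \<subseteq> \<F> \<and> 1 * (\<epsilon> * W n) \<le> 1 * real (card (\<F> \<inter> O' n))}"
    have pn: "0 \<le> p n" using p[of n] by simp
    have W: "p n * real n \<le> W n"
      unfolding W_def using pn central_binomial_ge[OF elim(3)] by (intro mult_left_mono) auto
    have "{\<F>. \<F> \<subseteq> Pow {1..n} \<and> (\<exists>I\<subseteq>\<F>. antichain I \<and> (1 + 4 * \<epsilon>) * W n \<le> real (card I))} \<subseteq> ?B1 \<union> ?B2"
    proof clarify
      fix \<F> I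
      assume F: "\<F> \<subseteq> Pow {1..n}" and I: "I \<subseteq> \<F>" "antichain I" "(1 + 4 * \<epsilon>) * W n \<le> real (card I)"
        and not2: "\<not> ({} \<subseteq> \<F> \<and> 1 * (\<epsilon> * W n) \<le> 1 * real (card (\<F> \<inter> O' n)))"
      have "finite \<F>" using F by (rule finite_subset) simp
      have "I \<subseteq> (I \<inter> V n) \<union> (\<F> \<inter> O' n)" using I F by (auto simp: V_def O'_def)
      then have "card I \<le> card ((I \<inter> V n) \<union> (\<F> \<inter> O' n))"
        using \<open>finite \<F>\<close> I(1) by (intro card_mono) (auto intro: finite_subset)
      also have "\<dots> \<le> card (I \<inter> V n) + card (\<F> \<inter> O' n)" by (rule card_Un_le)
      finally have "(1 + 3 * \<epsilon>) * W n \<le> real (card (I \<inter> V n))"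
        using I(3) not2 by (simp add: algebra_simps)
      moreover have "antichain (I \<inter> V n)" using I(2) by (auto simp: antichain_def)
      moreover have "I \<inter> V n \<subseteq> \<F> \<inter> V n" using I(1) by auto
      ultimately show "\<exists>I\<subseteq>\<F> \<inter> V n. antichain I \<and> (1 + 3 * \<epsilon>) * W n \<le> real (card I)"
        by (intro exI[of _ "I \<inter> V n"] conjI)
    qed
    then have "measure_pmf.prob ?M {\<F>. \<F> \<subseteq> Pow {1..n} \<and> (\<exists>I\<subseteq>\<F>. antichain I \<and> (1 + 4 * \<epsilon>) * W n \<le> real (card I))}
        \<le> measure_pmf.prob ?M (?B1 \<union> ?B2)" by (intro measure_pmf.finite_measure_mono) auto
    also have "\<dots> \<le> measure_pmf.prob ?M ?B1 + measure_pmf.prob ?M ?B2"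
      by (intro measure_Un_le) auto
    also have "\<dots> \<le> exp (- c * (p n * real n)) + exp (- c * (p n * real n))"
    proof (rule add_mono)
      show "measure_pmf.prob ?M ?B1 \<le> exp (- c * (p n * real n))"
        by (rule order.trans[OF elim(1)]) (use c pn in \<open>auto intro!: mult_right_mono\<close>)
      have "measure_pmf.prob ?M ?B2
          \<le> p n ^ card ({} :: nat set set) * exp (p n * (exp 1 - 1) * real (card (O' n)) - 1 * (\<epsilon> * W n))"
        by (rule prob_fingerprint) (use p in \<open>auto simp: O'_def\<close>)
      also have "\<dots> \<le> exp (- c * (p n * real n))"
      proof -
        \<comment> \<open>With at most \<epsilon> N / 4 sets in the upper part, the mean term is at
          most half of \<epsilon> W, so the exponent is at most - \<epsilon> W / 2.\<close>
        have "exp 1 - 1 \<le> (2 :: real)" using exp_bound[of 1] by simp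
        then have "p n * (exp 1 - 1) * real (card (O' n)) \<le> p n * 2 * (\<epsilon> / 4 * real (n choose (n div 2)))"
          using pn elim(2) by (intro mult_mono) auto
        also have "\<dots> = \<epsilon> / 2 * W n" by (simp add: W_def)
        finally have "p n * (exp 1 - 1) * real (card (O' n)) - \<epsilon> * W n \<le> - (\<epsilon> / 2 * W n)"
          by (simp add: algebra_simps)
        moreover have "c * (p n * real n) \<le> \<epsilon> / 2 * W n"
          using c W pn \<epsilon> by (intro mult_mono) auto
        ultimately show ?thesis by simp
      qed
      finally show "measure_pmf.prob ?M ?B2 \<le> exp (- c * (p n * real n))" .
    qed
    finally show ?case by simp
  qed
  with c show ?thesis by (auto simp: W_def mult.assoc)
qed

text \<open>The lower tail, from the same exponential moment bound at the negative parameter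
  \<open>- l\<close> and with empty fingerprint.\<close>

lemma eventually_prob_few_in_middle_layers:
  fixes p :: "nat \<Rightarrow> real" and \<epsilon> :: real
  assumes p: "\<And>n. p n \<in> {0..1}" and \<epsilon>: "\<epsilon> > 0"
  shows "\<exists>c>0. \<forall>\<^sub>F n in sequentially. measure_pmf.prob (random_family n (p n))
    {\<F>. real (card (\<F> \<inter> {A \<in> Pow {1..n}. card A \<in> {n div 2..<n div 2 + r}}))
        \<le> (real r - \<epsilon>) * p n * real (n choose (n div 2))} \<le> exp (- c * (p n * real n))"
proof -
  define L where "L n = {A \<in> Pow {1..n}. card A \<in> {n div 2..<n div 2 + r}}" for n
  define W where "W n = p n * real (n choose (n div 2))" for n
  \<comment> \<open>Small enough that (r - \<epsilon>) l \<le> \<epsilon> / 4, half of the gap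
    \<epsilon> / 2 between the threshold and the size of the layers. Using \<open>real r + 1\<close>
    keeps \<open>l\<close> well defined for \<open>r = 0\<close>.\<close>
  define l where "l = \<epsilon> / (4 * (real r + 1))"
  define c where "c = l / (1 + l) * (\<epsilon> / 4)"
  have l: "l > 0" using \<epsilon> by (simp add: l_def)
  have c: "c > 0" using l \<epsilon> by (simp add: c_def)
  have "\<forall>\<^sub>F n in sequentially. (real r - \<epsilon> / 2) * real (n choose (n div 2)) \<le> real (card (L n))"
    unfolding L_def using \<epsilon> by (intro eventually_card_middle_layers_ge) simp
  then have "\<forall>\<^sub>F n in sequentially. measure_pmf.prob (random_family n (p n))
    {\<F>. real (card (\<F> \<inter> L n)) \<le> (real r - \<epsilon>) * W n} \<le> exp (- c * (p n * real n))"
    using eventually_ge_at_top[of 1]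
  proof eventually_elim
    case (elim n)
    have pn: "0 \<le> p n" using p[of n] by simp
    have W: "p n * real n \<le> W n" "0 \<le> W n"
      unfolding W_def using pn central_binomial_ge[OF elim(2)] by (auto intro: mult_left_mono)
    have "{\<F>. real (card (\<F> \<inter> L n)) \<le> (real r - \<epsilon>) * W n}
      = {\<F>. {} \<subseteq> \<F> \<and> - l * ((real r - \<epsilon>) * W n) \<le> - l * real (card (\<F> \<inter> L n))}"
      using l by auto
    also have "measure_pmf.prob (random_family n (p n)) \<dots>
      \<le> p n ^ card ({} :: nat set set)
        * exp (p n * (exp (- l) - 1) * real (card (L n)) - (- l) * ((real r - \<epsilon>) * W n))"
      by (rule prob_fingerprint) (use p in \<open>auto simp: L_def\<close>)
    also have "\<dots> \<le> exp (- c * (p n * real n))"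
    proof -
      have "exp (- l) \<le> 1 / (1 + l)"
        using exp_ge_add_one_self[of l] l by (simp add: exp_minus field_simps)
      then have "exp (- l) - 1 \<le> - (l / (1 + l))" using l by (simp add: field_simps)
      then have "p n * (exp (- l) - 1) * real (card (L n)) \<le> p n * (- (l / (1 + l))) * real (card (L n))"
        using pn by (intro mult_right_mono mult_left_mono) auto
      also have "\<dots> \<le> p n * (- (l / (1 + l))) * ((real r - \<epsilon> / 2) * real (n choose (n div 2)))"
        using pn l elim(1) by (intro mult_left_mono_neg) (auto intro!: mult_nonneg_nonneg)
      also have "\<dots> = - (l / (1 + l)) * (real r - \<epsilon> / 2) * W n" by (simp add: W_def)
      finally have "p n * (exp (- l) - 1) * real (card (L n)) - (- l) * ((real r - \<epsilon>) * W n)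
          \<le> (l * (real r - \<epsilon>) - l / (1 + l) * (real r - \<epsilon> / 2)) * W n"
        by (simp add: algebra_simps)
      also have "\<dots> \<le> (- c) * W n"
      proof (rule mult_right_mono)
        have "(real r - \<epsilon>) * l \<le> real r * l" using \<epsilon> l by (intro mult_right_mono) auto
        also have "real r * l \<le> \<epsilon> / 4" using \<epsilon> by (simp add: l_def field_simps)
        finally have "(real r - \<epsilon>) * (1 + l) - (real r - \<epsilon> / 2) \<le> - (\<epsilon> / 4)"
          by (simp add: algebra_simps)
        then have "l / (1 + l) * ((real r - \<epsilon>) * (1 + l) - (real r - \<epsilon> / 2)) \<le> l / (1 + l) * (- (\<epsilon> / 4))"
          using l by (intro mult_left_mono) auto
        moreover have "l / (1 + l) * ((real r - \<epsilon>) * (1 + l) - (real r - \<epsilon> / 2))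
            = l * (real r - \<epsilon>) - l / (1 + l) * (real r - \<epsilon> / 2)"
          using l by (simp add: right_diff_distrib)
        ultimately show "l * (real r - \<epsilon>) - l / (1 + l) * (real r - \<epsilon> / 2) \<le> - c" by (simp add: c_def)
      qed (rule W)
      also have "\<dots> \<le> - c * (p n * real n)" using W c by simp
      finally show ?thesis by simp
    qed
    finally show ?case .
  qed
  with c show ?thesis by (auto simp: W_def L_def mult.assoc)
qed

theorem theorem1p1:
  fixes k :: nat and p :: "nat \<Rightarrow> real"
  assumes "k \<ge> 2"
    and "\<And>n. p n \<in> {0..1}"
    and "filterlim (\<lambda>n. p n * real n) at_top sequentially"
  shows "\<forall>\<epsilon>>0. (\<lambda>n. measure_pmf.prob (random_family n (p n))
            {\<F>. \<bar>real (max_k_chain_free k \<F>) - (real k - 1) * p n * real (n choose (n div 2))\<bar>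
                  \<le> \<epsilon> * p n * real (n choose (n div 2))}) \<longlonglongrightarrow> 1"
proof (intro allI impI)
  fix \<epsilon> :: real
  assume \<epsilon>: "\<epsilon> > 0"
  define W where "W n = p n * real (n choose (n div 2))" for n
  define L where "L n = {A \<in> Pow {1..n}. card A \<in> {n div 2..<n div 2 + (k - 1)}}" for n
  \<comment> \<open>The relative error 4 \<eta> is incurred once for each of the
    \<open>k - 1\<close> antichains, so the total stays below \<epsilon>.\<close>
  define \<eta> where "\<eta> = \<epsilon> / (4 * real k)"
  have \<eta>: "\<eta> > 0" using \<epsilon> assms(1) by (simp add: \<eta>_def)
  have W0: "W n \<ge> 0" for n using assms(2)[of n] by (simp add: W_def)
  define B1 where "B1 n = {\<F>. \<F> \<subseteq> Pow {1..n} \<and> (\<exists>I\<subseteq>\<F>. antichain I \<and> (1 + 4 * \<eta>) * W n \<le> real (card I))}" for n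
  define B2 where "B2 n = {\<F>. real (card (\<F> \<inter> L n)) \<le> (real (k - 1) - \<epsilon>) * W n}" for n
  define Good where "Good n = {\<F> :: nat set set. \<bar>real (max_k_chain_free k \<F>) - (real k - 1) * W n\<bar> \<le> \<epsilon> * W n}" for n
  define P where "P n = measure_pmf.prob (random_family n (p n))" for n
  obtain c1 where c1: "c1 > 0" "\<forall>\<^sub>F n in sequentially. P n (B1 n) \<le> 2 * exp (- c1 * (p n * real n))"
    using eventually_prob_large_antichain[OF assms(2,3) \<eta>] by (auto simp: P_def B1_def W_def mult.assoc)
  have "\<exists>c>0. \<forall>\<^sub>F n in sequentially. P n (B2 n) \<le> exp (- c * (p n * real n))"
    using eventually_prob_few_in_middle_layers[OF assms(2) \<epsilon>, where r = "k - 1"]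
    unfolding P_def B2_def W_def L_def mult.assoc .
  then obtain c2 where c2: "c2 > 0" "\<forall>\<^sub>F n in sequentially. P n (B2 n) \<le> exp (- c2 * (p n * real n))"
    by blast
  \<comment> \<open>This part is deterministic: avoiding \<open>B1\<close> bounds an optimal
    chain-free family from above, and avoiding \<open>B2\<close> makes \<F> \<inter> L n large
    enough from below.\<close>
  have good: "\<F> \<in> Good n" if "\<F> \<subseteq> Pow {1..n}" "\<F> \<notin> B1 n" "\<F> \<notin> B2 n" for \<F> n
  proof -
    have fin: "finite \<F>" using that(1) by (rule finite_subset) simp
    note mx = max_k_chain_free_bounds[OF fin, of k]
    have k1: "1 \<le> k" "Suc (k - 1) = k" "real (k - 1) = real k - 1" using assms(1) by auto
    obtain \<A> where A: "\<A> \<subseteq> \<F>" "k_chain_free k \<A>" "card \<A> = max_k_chain_free k \<F>"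
      using mx(2) k1 by blast
    have "real (card \<A>) \<le> real (k - 1) * ((1 + 4 * \<eta>) * W n)"
    proof (rule card_le_of_antichains)
      show "finite \<A>" using A(1) fin by (rule finite_subset)
      show "k_chain_free (Suc (k - 1)) \<A>" using A(2) unfolding k1(2) .
      fix I assume I: "I \<subseteq> \<A>" "antichain I"
      then have "\<not> (1 + 4 * \<eta>) * W n \<le> real (card I)"
        using A(1) that(1,2) unfolding B1_def by blast
      then show "real (card I) \<le> (1 + 4 * \<eta>) * W n" by linarith
    qed
    also have "\<dots> = (real k - 1) * W n + (real k - 1) / real k * (\<epsilon> * W n)"
      unfolding k1(3) using assms(1) by (simp add: \<eta>_def field_simps)
    also have "(real k - 1) / real k * (\<epsilon> * W n) \<le> 1 * (\<epsilon> * W n)"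
      using assms(1) \<epsilon> W0[of n] by (intro mult_right_mono) auto
    finally have upper: "real (max_k_chain_free k \<F>) \<le> (real k - 1) * W n + \<epsilon> * W n" using A(3) by simp
    have "k_chain_free k (\<F> \<inter> L n)"
      by (rule k_chain_free_of_card_range[of _ "n div 2"]) (use k1(1) in \<open>auto simp: L_def intro: finite_subset\<close>)
    then have "card (\<F> \<inter> L n) \<le> max_k_chain_free k \<F>" by (intro mx(1) k1(1)) auto
    moreover have "(real k - 1 - \<epsilon>) * W n < real (card (\<F> \<inter> L n))" using that(3) unfolding B2_def k1(3) by simp
    ultimately have "(real k - 1 - \<epsilon>) * W n \<le> real (max_k_chain_free k \<F>)" by linarith
    with upper show ?thesis by (simp add: Good_def algebra_simps abs_le_iff)
  qed
  have lower: "1 - (P n (B1 n) + P n (B2 n)) \<le> P n (Good n)" for n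
  proof -
    let ?M = "random_family n (p n)"
    \<comment> \<open>The comparison starts from the support, since \<open>good\<close> applies only
      to families inside the power set, whose finiteness makes the maximum meaningful.\<close>
    have "1 = P n (set_pmf ?M)" unfolding P_def using measure_Int_set_pmf[of ?M UNIV] by simp
    also have "\<dots> \<le> P n (Good n \<union> (B1 n \<union> B2 n))"
      unfolding P_def using good[OF set_pmf_random_family]
      by (intro measure_pmf.finite_measure_mono) (blast, simp)
    also have "\<dots> \<le> P n (Good n) + P n (B1 n \<union> B2 n)" unfolding P_def by (intro measure_Un_le) auto
    also have "P n (B1 n \<union> B2 n) \<le> P n (B1 n) + P n (B2 n)" unfolding P_def by (intro measure_Un_le) auto
    finally show ?thesis by simp
  qed
  have decay: "(\<lambda>n. exp (- c * (p n * real n))) \<longlonglongrightarrow> 0" if "c > 0" for c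
  proof -
    have "filterlim (\<lambda>n. c * (p n * real n)) at_top sequentially"
      using that assms(3) by (intro filterlim_tendsto_pos_mult_at_top[OF tendsto_const]) auto
    then have "filterlim (\<lambda>n. - (c * (p n * real n))) at_bot sequentially"
      by (simp add: filterlim_uminus_at_bot)
    then show ?thesis using filterlim_compose[OF exp_at_bot] by simp
  qed
  have "(\<lambda>n. 1 - (2 * exp (- c1 * (p n * real n)) + exp (- c2 * (p n * real n)))) \<longlonglongrightarrow> 1 - (2 * 0 + 0)"
    by (intro tendsto_intros decay c1 c2)
  then have lim: "(\<lambda>n. 1 - (2 * exp (- c1 * (p n * real n)) + exp (- c2 * (p n * real n)))) \<longlonglongrightarrow> 1"
    by simp
  have "\<forall>\<^sub>F n in sequentially.
      1 - (2 * exp (- c1 * (p n * real n)) + exp (- c2 * (p n * real n))) \<le> P n (Good n)"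
    using c1(2) c2(2)
  proof eventually_elim
    case (elim n)
    then show ?case using lower[of n] by linarith
  qed
  moreover have "\<forall>\<^sub>F n in sequentially. P n (Good n) \<le> 1" by (simp add: P_def)
  ultimately have "(\<lambda>n. P n (Good n)) \<longlonglongrightarrow> 1"
    using lim tendsto_const by (rule tendsto_sandwich)
  then show "(\<lambda>n. measure_pmf.prob (random_family n (p n))
            {\<F>. \<bar>real (max_k_chain_free k \<F>) - (real k - 1) * p n * real (n choose (n div 2))\<bar>
                  \<le> \<epsilon> * p n * real (n choose (n div 2))}) \<longlonglongrightarrow> 1"
    by (simp add: P_def Good_def W_def mult.assoc)
qed

end
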